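(* Let $d\ge1$ and let $f\in\mathcal{S}_d$ be a standard Schur function with Schur parameters $r:\mathbb{Z}_+\to\mathbb{D}$, variable allocation map $\nu$, convergents $f_n$, and associated polynomials $\Phi_n$ $(n\ge0)$. The sequence of measures $\mu_{f_n}$ $(n\ge1)$ converges weakly (in the dual space of $C(\mathbb{T}^d)$) to $\mu_f$, and the polynomials $\Phi_n$ $(n\ge0)$ are orthogonal on $\mathbb{T}^d$ with respect to $\mu_f$. More precisely, for any integers $j,k\ge0$, $$\int_{\mathbb{T}^d}\Phi_j\overline{\Phi_k}\,d\mu_f=\begin{cases}0&\text{if }j\ne k,\\ \prod_{s=1}^j(1-|r_s|^2)&\text{if }j=k.\end{cases}$$
   Context: Notation. $\mathbb{D}$ is the open unit disk, $\overline{\mathbb{D}}$ its closure, $\mathbb{T}$ the unit circle, $\mathbb{Z}_+$ the nonnegative integers, $\mathbb{Z}_{>0}$ the positive integers. $\mathcal{H}_d$ is the set of all holomorphic functions $h:\mathbb{D}^d\to\overline{\mathbb{D}}$, with the topology of uniform convergence on compact sets. $\mathbf{c}_r$ denotes the constant function with value $r$. For $1\le j\le d$ and $r\in\overline{\mathbb{D}}$ define operators on $\mathcal{H}_d$ by $(\mathfrak{m}_jh)(z)=z_jh(z)$; $(\mathfrak{g}_rh)(z)=\frac{h(z)+r}{1+\overline{r}h(z)}$ if $r\in\mathbb{D}$, and $\mathfrak{g}_rh=\mathbf{c}_r$ if $r\in\mathbb{T}$. Schur functions. $\mathcal{S}_d$ is the closure in $\mathcal{H}_d$ of the set of all functions $\mathfrak{g}_{r_0}\mathfrak{m}_{\nu_1}\cdots\mathfrak{g}_{r_{k-1}}\mathfrak{m}_{\nu_k}\mathbf{c}_0$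 with $k\ge1$, $r_i\in\mathbb{D}$, $\nu_i\in\{1,\dots,d\}$; its elements are called Schur functions. Every $f\in\mathcal{S}_d$ can be written $f=\mathfrak{g}_r\mathfrak{m}_jh$ with $r=f(0)$, some $1\le j\le d$, some $h\in\mathcal{S}_d$. Starting with $h_0=f$, iterate: set $r_n=h_n(0)$ and choose $\nu_{n+1}\in\{1,\dots,d\}$, $h_{n+1}\in\mathcal{S}_d$ with $h_n=\mathfrak{g}_{r_n}\mathfrak{m}_{\nu_{n+1}}h_{n+1}$ (if $h_n$ is constant, take $\nu_{n+1}=1$, $h_{n+1}=\mathbf{c}_0$). The $r_n$ $(n\ge0)$ are the Schur parameters, $\nu:\mathbb{Z}_{>0}\to\{1,\dots,d\}$ is the variable allocation map (any choice allowed), and $f_n=\mathfrak{g}_{r_0}\mathfrak{m}_{\nu_1}\mathfrak{g}_{r_1}\cdots\mathfrak{m}_{\nu_n}\mathfrak{g}_{r_n}\mathbf{c}_0$ is the $n$th convergent. $f$ is standard if $f(0)=0$ and $|r_n|<1$ for all $n\ge0$. Polynomials. Set $M_0=\begin{pmatrix}1&1\\-1&1\end{pmatrix}$, $M_n=\begin{pmatrix}z_{\nu_n}&r_nz_{\nu_n}\\ \overline{r_n}&1\end{pmatrix}$ $(n\ge1)$. The polynomials $\Psi_n,\Psi_n^\ast,\Phi_n,\Phi_n^\ast$ in $z\in\mathbb{C}^d$ are defined by $M_0M_1\cdots M_n=\begin{pmatrix}\Psi_n&\Psi_n^\ast\\-\Phi_n&\Phi_n^\ast\end{pmatrix}$ $(n\ge0)$.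 Measures. For $z=(s_1e^{i\phi_1},\dots,s_de^{i\phi_d})\in\mathbb{D}^d$ the Poisson kernel is $K_z(e^{i\theta_1},\dots,e^{i\theta_d})=\prod_{j=1}^d\frac{1-s_j^2}{1-2s_j\cos(\phi_j-\theta_j)+s_j^2}$. For $h\in\mathcal{H}_d$ with $h(0)=0$, $\mu_h$ is the unique positive Borel measure on $\mathbb{T}^d$ (a probability measure) such that $\Re\frac{1+h(z)}{1-h(z)}=\int_{\mathbb{T}^d}K_z\,d\mu_h$ for all $z\in\mathbb{D}^d$. This applies to $f$ and to each convergent $f_n$ (which satisfies $f_n(0)=0$). *)

theory Defs
  imports "HOL-Analysis.Analysis"
begin

text \<open>
  The dimension \<open>d \<ge> 1\<close> is the cardinality of the index type \<open>'d\<close>. A function on the open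
  polydisc is represented by a function on the whole space whose values outside the polydisc are
  irrelevant; accordingly, equations between such functions are only required on the polydisc.
\<close>

definition polydisc :: "(complex^'d::finite) set" where
  "polydisc = {z. \<forall>j. norm (z $ j) < 1}"

definition torus :: "(complex^'d::finite) set" where
  "torus = {w. \<forall>j. norm (w $ j) = 1}"

text \<open>Holomorphy in several variables: Frechet differentiable with complex-linear derivative.\<close>

definition holomorphic_on_polydisc :: "(complex^'d::finite \<Rightarrow> complex) \<Rightarrow> bool" where
  "holomorphic_on_polydisc h \<longleftrightarrow>
     (\<forall>z\<in>polydisc. \<exists>c::complex^'d. (h has_derivative (\<lambda>v. \<Sum>j\<in>UNIV. c $ j * v $ j)) (at z))"

definition hol_class :: "(complex^'d::finite \<Rightarrow> complex) set" where
  "hol_class = {h. holomorphic_on_polydisc h \<and> (\<forall>z\<in>polydisc. norm (h z) \<le> 1)}"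

text \<open>
  The topology of uniform convergence on compact subsets of the polydisc. It does not separate two
  representatives of the same function on the polydisc.
\<close>

definition compact_convergence_open :: "(complex^'d::finite \<Rightarrow> complex) set \<Rightarrow> bool" where
  "compact_convergence_open U \<longleftrightarrow> U \<subseteq> hol_class \<and>
     (\<forall>f\<in>U. \<exists>K e. compact K \<and> K \<subseteq> polydisc \<and> 0 < e \<and>
        {g \<in> hol_class. \<forall>z\<in>K. norm (g z - f z) < e} \<subseteq> U)"

definition compact_convergence :: "(complex^'d::finite \<Rightarrow> complex) topology" where
  "compact_convergence = topology compact_convergence_open"

lemma istopology_compact_convergence_open: "istopology compact_convergence_open"
  unfolding istopology_def
proof (intro conjI allI impI)
  fix S T :: "(complex^'d \<Rightarrow> complex) set"
  assume S: "compact_convergence_open S" and T: "compact_convergence_open T"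
  show "compact_convergence_open (S \<inter> T)"
    unfolding compact_convergence_open_def
  proof (intro conjI ballI)
    show "S \<inter> T \<subseteq> hol_class"
      using S by (auto simp: compact_convergence_open_def)
    fix f assume f: "f \<in> S \<inter> T"
    obtain K e where K: "compact K" "K \<subseteq> polydisc" "0 < e"
        "{g \<in> hol_class. \<forall>z\<in>K. norm (g z - f z) < e} \<subseteq> S"
      using S f unfolding compact_convergence_open_def by (meson IntD1)
    obtain L d where L: "compact L" "L \<subseteq> polydisc" "0 < d"
        "{g \<in> hol_class. \<forall>z\<in>L. norm (g z - f z) < d} \<subseteq> T"
      using T f unfolding compact_convergence_open_def by (meson IntD2)
    have "{g \<in> hol_class. \<forall>z\<in>K \<union> L. norm (g z - f z) < min e d} \<subseteq> S \<inter> T"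
      using K(4) L(4) by auto
    moreover have "compact (K \<union> L)" "K \<union> L \<subseteq> polydisc" "0 < min e d"
      using K L by auto
    ultimately show "\<exists>K e. compact K \<and> K \<subseteq> polydisc \<and> 0 < e \<and>
        {g \<in> hol_class. \<forall>z\<in>K. norm (g z - f z) < e} \<subseteq> S \<inter> T"
      by (intro exI[of _ "K \<union> L"] exI[of _ "min e d"] conjI)
  qed
next
  fix \<K> :: "(complex^'d \<Rightarrow> complex) set set"
  assume *: "\<forall>S\<in>\<K>. compact_convergence_open S"
  show "compact_convergence_open (\<Union>\<K>)"
    unfolding compact_convergence_open_def
  proof (intro conjI ballI)
    show "\<Union>\<K> \<subseteq> hol_class"
      using * by (auto simp: compact_convergence_open_def)
    fix f assume "f \<in> \<Union>\<K>"
    then obtain S where S: "S \<in> \<K>" "f \<in> S" by blast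
    then obtain K e where K: "compact K" "K \<subseteq> polydisc" "0 < e"
        "{g \<in> hol_class. \<forall>z\<in>K. norm (g z - f z) < e} \<subseteq> S"
      using * unfolding compact_convergence_open_def by meson
    have "{g \<in> hol_class. \<forall>z\<in>K. norm (g z - f z) < e} \<subseteq> \<Union>\<K>"
      by (rule order_trans[OF K(4) Union_upper[OF S(1)]])
    with K(1-3) show "\<exists>K e. compact K \<and> K \<subseteq> polydisc \<and> 0 < e \<and>
        {g \<in> hol_class. \<forall>z\<in>K. norm (g z - f z) < e} \<subseteq> \<Union>\<K>"
      by (intro exI[of _ K] exI[of _ e] conjI)
  qed
qed

lemma openin_compact_convergence:
  "openin compact_convergence U \<longleftrightarrow> compact_convergence_open U"
  by (simp add: compact_convergence_def istopology_compact_convergence_open)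

lemma topspace_compact_convergence: "topspace compact_convergence = hol_class"
proof -
  have "compact_convergence_open hol_class"
    unfolding compact_convergence_open_def
    by (intro conjI ballI exI[of _ "{}"] exI[of _ "1::real"]) auto
  then show ?thesis
    unfolding topspace_def openin_compact_convergence
    by (intro antisym Union_least Union_upper) (simp_all add: compact_convergence_open_def)
qed

definition m_op :: "'d::finite \<Rightarrow> (complex^'d \<Rightarrow> complex) \<Rightarrow> complex^'d \<Rightarrow> complex" where
  "m_op j h = (\<lambda>z. z $ j * h z)"

text \<open>Used only for \<open>norm r \<le> 1\<close>; the second branch is the case \<open>norm r = 1\<close>.\<close>

definition g_op :: "complex \<Rightarrow> (complex^'d::finite \<Rightarrow> complex) \<Rightarrow> complex^'d \<Rightarrow> complex" where
  "g_op r h = (\<lambda>z. if norm r < 1 then (h z + r) / (1 + cnj r * h z) else r)"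

definition finite_schur_functions :: "(complex^'d::finite \<Rightarrow> complex) set" where
  "finite_schur_functions =
     {foldr (\<lambda>(r, j) h. g_op r (m_op j h)) ps (\<lambda>_. 0) | ps.
        ps \<noteq> [] \<and> (\<forall>(r, j)\<in>set ps. norm r < 1)}"

definition schur_class :: "(complex^'d::finite \<Rightarrow> complex) set" where
  "schur_class = compact_convergence closure_of finite_schur_functions"

text \<open>
  \<open>r\<close>, \<open>\<nu>\<close> and \<open>h\<close> arise from \<open>f\<close> by the Schur algorithm; \<open>\<nu> 0\<close> is not used. When \<open>h n\<close> is
  constant, the value of \<open>\<nu> (Suc n)\<close> is immaterial and is left arbitrary, and the recursion holds
  automatically for \<open>h (Suc n) = 0\<close>.
\<close>

definition schur_algorithm ::
  "(complex^'d::finite \<Rightarrow> complex) \<Rightarrow> (nat \<Rightarrow> complex) \<Rightarrow> (nat \<Rightarrow> 'd) \<Rightarrow>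
   (nat \<Rightarrow> complex^'d \<Rightarrow> complex) \<Rightarrow> bool" where
  "schur_algorithm f r \<nu> h \<longleftrightarrow>
     h 0 = f \<and>
     (\<forall>n. h n \<in> schur_class \<and> r n = h n 0 \<and>
        (\<forall>z\<in>polydisc. h n z = g_op (r n) (m_op (\<nu> (Suc n)) (h (Suc n))) z) \<and>
        ((\<exists>c. \<forall>z\<in>polydisc. h n z = c) \<longrightarrow> (\<forall>z\<in>polydisc. h (Suc n) z = 0)))"

definition schur_parameters ::
  "(complex^'d::finite \<Rightarrow> complex) \<Rightarrow> (nat \<Rightarrow> complex) \<Rightarrow> (nat \<Rightarrow> 'd) \<Rightarrow> bool" where
  "schur_parameters f r \<nu> \<longleftrightarrow> (\<exists>h. schur_algorithm f r \<nu> h)"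

definition standard_schur :: "(complex^'d::finite \<Rightarrow> complex) \<Rightarrow> (nat \<Rightarrow> complex) \<Rightarrow> bool" where
  "standard_schur f r \<longleftrightarrow> f 0 = 0 \<and> (\<forall>n. norm (r n) < 1)"

definition convergent_fun ::
  "(nat \<Rightarrow> complex) \<Rightarrow> (nat \<Rightarrow> 'd::finite) \<Rightarrow> nat \<Rightarrow> complex^'d \<Rightarrow> complex" where
  "convergent_fun r \<nu> n =
     foldr (\<lambda>i h. g_op (r i) (m_op (\<nu> (Suc i)) h)) [0..<n] (g_op (r n) (\<lambda>_. 0))"

text \<open>Polynomials in \<open>z\<close> are represented by the associated polynomial functions.\<close>

definition M_zero :: "complex^2^2" where
  "M_zero = vector [vector [1, 1], vector [-1, 1]]"

definition M_step ::
  "(nat \<Rightarrow> complex) \<Rightarrow> (nat \<Rightarrow> 'd::finite) \<Rightarrow> nat \<Rightarrow> complex^'d \<Rightarrow> complex^2^2" where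
  "M_step r \<nu> n z =
     vector [vector [z $ \<nu> n, r n * z $ \<nu> n], vector [cnj (r n), 1]]"

primrec M_prod ::
  "(nat \<Rightarrow> complex) \<Rightarrow> (nat \<Rightarrow> 'd::finite) \<Rightarrow> nat \<Rightarrow> complex^'d \<Rightarrow> complex^2^2" where
  "M_prod r \<nu> 0 z = M_zero"
| "M_prod r \<nu> (Suc n) z = M_prod r \<nu> n z ** M_step r \<nu> (Suc n) z"

definition Psi :: "(nat \<Rightarrow> complex) \<Rightarrow> (nat \<Rightarrow> 'd::finite) \<Rightarrow> nat \<Rightarrow> complex^'d \<Rightarrow> complex" where
  "Psi r \<nu> n z = M_prod r \<nu> n z $ 1 $ 1"

definition Psi_star :: "(nat \<Rightarrow> complex) \<Rightarrow> (nat \<Rightarrow> 'd::finite) \<Rightarrow> nat \<Rightarrow> complex^'d \<Rightarrow> complex" where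
  "Psi_star r \<nu> n z = M_prod r \<nu> n z $ 1 $ 2"

definition Phi :: "(nat \<Rightarrow> complex) \<Rightarrow> (nat \<Rightarrow> 'd::finite) \<Rightarrow> nat \<Rightarrow> complex^'d \<Rightarrow> complex" where
  "Phi r \<nu> n z = - (M_prod r \<nu> n z $ 2 $ 1)"

definition Phi_star :: "(nat \<Rightarrow> complex) \<Rightarrow> (nat \<Rightarrow> 'd::finite) \<Rightarrow> nat \<Rightarrow> complex^'d \<Rightarrow> complex" where
  "Phi_star r \<nu> n z = M_prod r \<nu> n z $ 2 $ 2"

definition poisson_kernel :: "complex^'d::finite \<Rightarrow> complex^'d \<Rightarrow> real" where
  "poisson_kernel z w =
     (\<Prod>j\<in>UNIV. (1 - (norm (z $ j))\<^sup>2) /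
        (1 - 2 * norm (z $ j) * cos (Arg (z $ j) - Arg (w $ j)) + (norm (z $ j))\<^sup>2))"

definition represents_on_torus ::
  "(complex^'d::finite) measure \<Rightarrow> (complex^'d \<Rightarrow> complex) \<Rightarrow> bool" where
  "represents_on_torus M h \<longleftrightarrow>
     sets M = sets (restrict_space borel torus) \<and>
     (\<forall>z\<in>polydisc. has_bochner_integral M (poisson_kernel z) (Re ((1 + h z) / (1 - h z))))"

definition mu :: "(complex^'d::finite \<Rightarrow> complex) \<Rightarrow> (complex^'d) measure" where
  "mu h = (THE M. represents_on_torus M h)"

definition converges_weakly_on_torus ::
  "(nat \<Rightarrow> (complex^'d::finite) measure) \<Rightarrow> (complex^'d) measure \<Rightarrow> bool" where
  "converges_weakly_on_torus Ms M \<longleftrightarrow>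
     (\<forall>u :: complex^'d \<Rightarrow> complex. continuous_on torus u \<longrightarrow>
        (\<lambda>n. integral\<^sup>L (Ms n) u) \<longlonglongrightarrow> integral\<^sup>L M u)"

end

theory Submission
  imports Defs "HOL-Probability.Probability" "HOL-Complex_Analysis.Cauchy_Integral_Formula"
begin

text \<open>
  A convergent \<open>f\<^sub>n\<close> is holomorphic inside the polydisc and continuous up to its
  boundary, and its norm stays below 1 there. So the measure of \<open>f\<^sub>n\<close> is the Haar measure of the torus with the density
  \<open>Re ((1 + f\<^sub>n) / (1 - f\<^sub>n))\<close> (\<open>cayley_density\<close>, from the Poisson formula \<open>poisson_formula_torus\<close>).

  Fix \<open>k \<le> j \<le> n\<close>. After \<open>j\<close> steps of the Schur algorithm, \<open>f\<^sub>n\<close> is a linear fractional function of a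
  remainder \<open>y\<close> that vanishes at the origin, and on the torus the density is
  \<open>(\<Prod>s=1..j. 1 - (norm (r s))\<^sup>2) * (1 - (norm y)\<^sup>2) / (norm (\<Phi>\<^sub>j\<^sup>* - y * \<Phi>\<^sub>j))\<^sup>2\<close> (\<open>density_transfer\<close>).
  There \<open>\<Phi>\<^sub>j\<^sup>*\<close> is the reversed polynomial of \<open>\<Phi>\<^sub>j\<close>, and it has no zeros on the closed polydisc.
  Therefore \<open>\<Phi>\<^sub>j * cnj \<Phi>\<^sub>k\<close> times the density is the sum of a function that is holomorphic inside the
  polydisc and the conjugate of one, and the mean value property gives its integral
  (\<open>integral_Phi_against_density\<close>). The result does not depend on \<open>n\<close>.

  It remains to pass to the limit. In the hyperbolic metric the maps of the Schur algorithm contract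
  uniformly at each point of the polydisc, so \<open>f\<^sub>n\<close> tends to \<open>f\<close> pointwise
  (\<open>schur_tail_tendsto\<close>), and the Poisson integrals converge. Weak convergence can be tested on
  Poisson kernels, because their linear span is dense in the continuous functions
  (\<open>weak_convergence_from_poisson_integrals\<close>); the same density shows that a measure is determined by its
  Poisson integrals. A measure that represents \<open>f\<close> exists because a sequence of probability measures on
  the torus has a weakly convergent subsequence (\<open>prob_measures_on_torus_compact\<close>), and the limit has the
  required Poisson integrals.
\<close>

section \<open>A space-filling curve and weak compactness of measures on the torus\<close>

text \<open>
  A continuous function with period 2 that is 0 on \<open>[0, 1/3]\<close> and 1 on \<open>[2/3, 1]\<close>. Such a
  function reads the digits of an element of Cantor's ternary set.
\<close>
definition ramp :: "real \<Rightarrow> real" where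
  "ramp t = max 0 (min 1 (1/2 - cos (pi * t)))"

lemma continuous_ramp [continuous_intros]:
  fixes f :: "real \<Rightarrow> real"
  assumes "continuous_on A f"
  shows "continuous_on A (\<lambda>x. ramp (f x))"
  unfolding ramp_def using assms by (intro continuous_intros)

lemma ramp_range: "0 \<le> ramp t" "ramp t \<le> 1"
  by (auto simp: ramp_def)

lemma ramp_periodic: "ramp (2 * real k + t) = ramp t"
proof -
  have "cos (pi * (2 * real k + t)) = cos (pi * t + 2 * real k * pi)"
    by (simp add: algebra_simps)
  also have "\<dots> = cos (pi * t)"
    by (simp add: cos_add)
  finally show ?thesis by (simp add: ramp_def)
qed

lemma cos_pi_third_bounds:
  assumes "0 \<le> t" "t \<le> 1/3"
  shows "cos (pi * t) \<ge> 1/2"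
proof -
  have "cos (pi / 3) \<le> cos (pi * t)"
    using assms by (intro cos_monotone_0_pi_le) (auto simp: field_simps)
  then show ?thesis by (simp add: cos_60)
qed

lemma ramp_digit:
  assumes "b \<in> {0, 1}" "0 \<le> t" "t \<le> 1"
  shows "ramp (2 * real b / 3 + t / 3) = real b"
proof (cases "b = 0")
  case True
  then show ?thesis
    using cos_pi_third_bounds[of "t/3"] assms by (simp add: ramp_def)
next
  case False
  have "cos (pi * (2 / 3 + t / 3)) = - cos (pi * ((1 - t) / 3))"
  proof -
    have "pi * (2 / 3 + t / 3) = pi - pi * ((1 - t) / 3)"
      by (simp add: field_simps)
    then show ?thesis by (metis cos_pi_minus)
  qed
  then show ?thesis
    using cos_pi_third_bounds[of "(1 - t)/3"] assms False by (simp add: ramp_def)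
qed

text \<open>
  Elements of Cantor's ternary set, coded by their digits 0 or 1 (in base 3 the digits are
  0 or 2).
\<close>
definition ternary :: "(nat \<Rightarrow> nat) \<Rightarrow> real" where
  "ternary b = (\<Sum>i. 2 * real (b i) / 3 ^ Suc i)"

lemma ternary_props:
  assumes "\<And>i. b i \<in> {0, 1}"
  shows ternary_summable: "summable (\<lambda>i. 2 * real (b i) / 3 ^ Suc i)"
    and ternary_bounds: "0 \<le> ternary b" "ternary b \<le> 1"
proof -
  have b: "b i \<le> 1" for i using assms[of i] by auto
  have geo: "(\<lambda>i. (2/3) * (1/3) ^ i :: real) sums 1"
    using sums_mult[OF geometric_sums[of "1/3 :: real"], of "2/3"] by simp
  have le: "2 * real (b i) / 3 ^ Suc i \<le> (2/3) * (1/3) ^ i" for i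
    using b[of i] by (simp add: field_simps)
  show s: "summable (\<lambda>i. 2 * real (b i) / 3 ^ Suc i)"
    by (rule summable_comparison_test'[OF sums_summable[OF geo], of 0])
      (use le in auto)
  show "0 \<le> ternary b" unfolding ternary_def by (intro suminf_nonneg s) auto
  have "ternary b \<le> (\<Sum>i. (2/3) * (1/3) ^ i :: real)"
    unfolding ternary_def by (intro suminf_le s sums_summable[OF geo] le)
  then show "ternary b \<le> 1" using sums_unique[OF geo] by simp
qed

lemma ternary_rec:
  assumes "\<And>i. b i \<in> {0, 1}"
  shows "3 * ternary b = 2 * real (b 0) + ternary (\<lambda>i. b (Suc i))"
proof -
  have "ternary b = 2 * real (b 0) / 3 + (\<Sum>i. 2 * real (b (Suc i)) / 3 ^ Suc (Suc i))"
    unfolding ternary_def using suminf_split_head[OF ternary_summable[of b, OF assms]] by simp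
  also have "(\<Sum>i. 2 * real (b (Suc i)) / 3 ^ Suc (Suc i)) = ternary (\<lambda>i. b (Suc i)) / 3"
    unfolding ternary_def
    using suminf_divide[OF ternary_summable[of "\<lambda>i. b (Suc i)"], of 3] assms
    by (simp add: field_simps)
  finally show ?thesis by simp
qed

text \<open>
  Multiplication by 3 shifts the digits and adds an even integer, which \<open>ramp\<close> does not see; so
  \<open>ramp\<close> after the multiplication by \<open>3 ^ m\<close> reads the digit number \<open>m\<close>.
\<close>
lemma ramp_ternary:
  assumes "\<And>i. b i \<in> {0, 1}"
  shows "ramp (3 ^ m * ternary b) = real (b m)"
  using assms
proof (induction m arbitrary: b)
  case 0
  have "ternary b = 2 * real (b 0) / 3 + ternary (\<lambda>i. b (Suc i)) / 3"
    using ternary_rec[of b, OF 0] by simp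
  then show ?case
    using ramp_digit[of "b 0" "ternary (\<lambda>i. b (Suc i))"] ternary_bounds[of "\<lambda>i. b (Suc i)"] 0
    by simp
next
  case (Suc m)
  have "3 ^ Suc m * ternary b = 3 ^ m * (3 * ternary b)"
    by simp
  also have "\<dots> = 2 * real (3 ^ m * b 0) + 3 ^ m * ternary (\<lambda>i. b (Suc i))"
    unfolding ternary_rec[of b, OF Suc.prems] by (simp add: algebra_simps)
  finally have "3 ^ Suc m * ternary b = \<dots>" .
  then show ?case
    using Suc.IH[of "\<lambda>i. b (Suc i)"] Suc.prems by (simp only: ramp_periodic)
qed

lemma binary_expansion_exists:
  assumes "0 \<le> x" "x \<le> (1::real)"
  obtains b :: "nat \<Rightarrow> nat" where "\<And>i. b i \<in> {0, 1}" "(\<lambda>i. real (b i) / 2 ^ Suc i) sums x"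
proof -
  define digit :: "real \<Rightarrow> nat" where "digit y = (if y \<ge> 1/2 then 1 else 0)" for y
  define rem where "rem n = ((\<lambda>y. 2 * y - real (digit y)) ^^ n) x" for n
  have rem01: "0 \<le> rem n \<and> rem n \<le> 1" for n
    by (induction n) (use assms in \<open>auto simp: rem_def digit_def\<close>)
  have "(\<Sum>i<n. real (digit (rem i)) / 2 ^ Suc i) = x - rem n / 2 ^ n" for n
    by (induction n) (auto simp: rem_def field_simps)
  moreover have "(\<lambda>n. x - rem n / 2 ^ n) \<longlonglongrightarrow> x - 0"
  proof (intro tendsto_diff tendsto_const)
    show "(\<lambda>n. rem n / 2 ^ n) \<longlonglongrightarrow> 0"
    proof (rule Lim_null_comparison)
      show "\<forall>\<^sub>F n in sequentially. norm (rem n / 2 ^ n) \<le> (1/2) ^ n"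
        using rem01 by (auto simp: field_simps)
    qed (simp add: LIMSEQ_realpow_zero)
  qed
  ultimately have "(\<lambda>i. real (digit (rem i)) / 2 ^ Suc i) sums x"
    by (simp add: sums_def)
  then show ?thesis
    by (intro that[of "\<lambda>i. digit (rem i)"]) (auto simp: digit_def)
qed

text \<open>
  Schoenberg's space-filling curve, wrapped around the torus. For \<open>t\<close> in Cantor's set, the angle in the
  coordinate \<open>j\<close> has as its binary digits the digits of \<open>t\<close> at the places \<open>to_nat (j, k)\<close>; since these
  places are distinct for distinct pairs, all angles can be prescribed independently.
\<close>
definition torus_curve :: "real \<Rightarrow> complex^'d::finite" where
  "torus_curve t =
     (\<chi> j. cis (2 * pi * (\<Sum>k. ramp (3 ^ to_nat (j, k) * t) / 2 ^ Suc k)))"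

lemma torus_curve_in_torus: "torus_curve t \<in> torus"
  by (simp add: torus_def torus_curve_def)

lemma continuous_torus_curve: "continuous_on UNIV (torus_curve :: real \<Rightarrow> complex^'d::finite)"
proof -
  have "continuous_on UNIV (\<lambda>t. \<Sum>k. ramp (3 ^ to_nat (j, k) * t) / 2 ^ Suc k)" for j :: 'd
  proof (rule uniform_limit_theorem)
    show "uniform_limit UNIV (\<lambda>n t. \<Sum>k<n. ramp (3 ^ to_nat (j, k) * t) / 2 ^ Suc k)
            (\<lambda>t. \<Sum>k. ramp (3 ^ to_nat (j, k) * t) / 2 ^ Suc k) sequentially"
    proof (rule Weierstrass_m_test)
      show "norm (ramp (3 ^ to_nat (j, k) * t) / 2 ^ Suc k) \<le> (1/2) ^ Suc k" for k t
        using ramp_range[of "3 ^ to_nat (j, k) * t"] by (simp add: field_simps)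
      show "summable (\<lambda>k. (1/2) ^ Suc k :: real)"
        by (simp only: summable_Suc_iff) (simp add: summable_geometric)
    qed
    show "\<forall>\<^sub>F n in sequentially.
        continuous_on UNIV (\<lambda>t. \<Sum>k<n. ramp (3 ^ to_nat (j, k) * t) / 2 ^ Suc k)"
      by (intro always_eventually allI continuous_intros) auto
  qed simp
  then show ?thesis
    unfolding torus_curve_def
    by (intro continuous_on_vec_lambda continuous_on_compose2[OF continuous_on_cis] continuous_intros)
qed

lemma torus_curve_surj:
  assumes "w \<in> (torus :: (complex^'d::finite) set)"
  obtains t where "t \<in> {0..1}" "torus_curve t = w"
proof -
  have "\<exists>x. 0 \<le> x \<and> x \<le> 1 \<and> cis (2 * pi * x) = w $ j" for j
  proof -
    have "norm (w $ j) = 1" using assms by (simp add: torus_def)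
    then obtain s where s: "0 \<le> s" "s < 2 * pi" "w $ j = cis s"
      by (metis Arg2pi_ge_0 Arg2pi_lt_2pi Arg2pi_eq cis_conv_exp mult_1 of_real_1)
    then show ?thesis by (intro exI[of _ "s / (2 * pi)"]) auto
  qed
  then obtain x where x: "\<And>j. 0 \<le> x j \<and> x j \<le> 1 \<and> cis (2 * pi * x j) = w $ j" by metis
  have "\<exists>b :: nat \<Rightarrow> nat. (\<forall>i. b i \<in> {0, 1}) \<and> (\<lambda>i. real (b i) / 2 ^ Suc i) sums x j" for j
    by (rule binary_expansion_exists[of "x j"]) (use x in auto)
  then obtain b :: "'d \<Rightarrow> nat \<Rightarrow> nat" where
    b: "\<And>j i. b j i \<in> {0, 1}" and bx: "\<And>j. (\<lambda>i. real (b j i) / 2 ^ Suc i) sums x j"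
    by metis
  define c where "c = (\<lambda>i. case from_nat i of (j, k) \<Rightarrow> b j k)"
  have c: "c i \<in> {0, 1}" for i
    unfolding c_def using b by (auto split: prod.split)
  have "(\<Sum>k. ramp (3 ^ to_nat (j, k) * ternary c) / 2 ^ Suc k) = x j" for j
    using sums_unique[OF bx[of j]] by (simp add: ramp_ternary[OF c]) (simp add: c_def)
  then have "torus_curve (ternary c) = w"
    using x by (simp add: torus_curve_def vec_eq_iff)
  then show ?thesis using that[of "ternary c"] ternary_bounds[OF c] by simp
qed

text \<open>
  The first time at which the curve passes through \<open>w\<close>. This section of the curve is lower
  semicontinuous: its sublevel sets are images of compact intervals. Hence it is Borel measurable,
  which an arbitrary section need not be.
\<close>
definition curve_param :: "complex^'d::finite \<Rightarrow> real" where
  "curve_param w = Inf {t \<in> {0..1}. torus_curve t = w}"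

lemma curve_param_mem:
  assumes "w \<in> (torus :: (complex^'d::finite) set)"
  shows "curve_param w \<in> {0..1}" "torus_curve (curve_param w) = w"
proof -
  let ?S = "{t \<in> {0..1}. torus_curve t = w}"
  have "closed (torus_curve -` {w})"
    by (intro continuous_closed_vimage) (use continuous_torus_curve in \<open>auto simp: continuous_on_eq_continuous_at\<close>)
  then have "closed ({0..1} \<inter> torus_curve -` {w})" by (intro closed_Int) auto
  moreover have "?S = {0..1} \<inter> torus_curve -` {w}" by auto
  ultimately have "closed ?S" by simp
  moreover have "?S \<noteq> {}" using torus_curve_surj[OF assms] by blast
  moreover have "bdd_below ?S" by (rule bdd_belowI[of _ 0]) auto
  ultimately have "Inf ?S \<in> ?S" by (intro closed_contains_Inf)
  then show "curve_param w \<in> {0..1}" "torus_curve (curve_param w) = w"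
    by (auto simp: curve_param_def)
qed

lemma compact_torus: "compact (torus :: (complex^'d::finite) set)"
proof -
  have "(torus :: (complex^'d) set) = torus_curve ` {0..1}"
  proof (intro antisym subsetI)
    fix w :: "complex^'d" assume "w \<in> torus"
    then show "w \<in> torus_curve ` {0..1}" by (rule torus_curve_surj) auto
  qed (auto simp: torus_curve_in_torus)
  moreover have "compact (torus_curve ` {0..1} :: (complex^'d) set)"
    by (intro compact_continuous_image continuous_on_subset[OF continuous_torus_curve]) auto
  ultimately show ?thesis by simp
qed

lemma torus_in_borel: "torus \<in> sets (borel :: (complex^'d::finite) measure)"
  by (rule borel_compact[OF compact_torus])

lemma borel_measurable_curve_param:
  "curve_param \<in> borel_measurable (restrict_space borel (torus :: (complex^'d::finite) set))"
proof (rule borel_measurableI_le)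
  fix a
  have "{w \<in> torus. curve_param w \<le> a} = (torus_curve ` ({0..1} \<inter> {..a}) :: (complex^'d) set)"
    (is "?L = ?R")
  proof (intro antisym subsetI)
    fix w assume "w \<in> ?L"
    then have "w = torus_curve (curve_param w)" "curve_param w \<in> {0..1} \<inter> {..a}"
      using curve_param_mem[of w] by auto
    then show "w \<in> ?R" by (rule image_eqI)
  next
    fix w assume "w \<in> ?R"
    then obtain t where t: "w = torus_curve t" "0 \<le> t" "t \<le> 1" "t \<le> a" by auto
    have "curve_param w \<le> t"
      unfolding curve_param_def by (rule cInf_lower) (use t in \<open>auto intro!: bdd_belowI[of _ 0]\<close>)
    then show "w \<in> ?L" using t by (auto simp: torus_curve_in_torus)
  qed
  moreover have "compact (torus_curve ` ({0..1} \<inter> {..a}) :: (complex^'d) set)"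
    by (intro compact_continuous_image continuous_on_subset[OF continuous_torus_curve]
        compact_Int_closed) auto
  then have "torus_curve ` ({0..1} \<inter> {..a}) \<in> sets (restrict_space borel (torus :: (complex^'d) set))"
    using torus_in_borel
    by (subst sets_restrict_space_iff) (auto simp: torus_curve_in_torus intro: borel_compact)
  ultimately show "{w \<in> space (restrict_space borel (torus :: (complex^'d) set)). curve_param w \<le> a} \<in>
      sets (restrict_space borel torus)"
    by (simp add: space_restrict_space)
qed

text \<open>
  The theorem of Helly and Prokhorov on the torus, reduced to the real line: the section of the
  curve transports the measures to \<open>[0, 1]\<close>, Helly's selection theorem gives a limit on the line,
  and the curve, being continuous and defined on the whole line, transports weak convergence back.
  So the boundaries of multidimensional boxes never have to be discussed.
\<close>
lemma prob_measures_on_torus_compact: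
  fixes N :: "nat \<Rightarrow> (complex^'d::finite) measure"
  assumes prob: "\<And>n. prob_space (N n)"
    and sets: "\<And>n. sets (N n) = sets (restrict_space borel torus)"
  obtains s :: "nat \<Rightarrow> nat" and M where "strict_mono s" "prob_space M"
    "sets M = sets (restrict_space borel torus)" "converges_weakly_on_torus (N \<circ> s) M"
proof -
  let ?T = "restrict_space borel torus :: (complex^'d) measure"
  have spaceN: "space (N n) = torus" for n
    using sets_eq_imp_space_eq[OF sets, of n] by (simp add: space_restrict_space)
  have meas_s: "curve_param \<in> borel_measurable (N n)" for n
    using borel_measurable_curve_param by (simp add: measurable_cong_sets[OF sets refl])
  have meas_c: "torus_curve \<in> measurable borel ?T"
    by (intro measurable_restrict_space2)
      (auto simp: torus_curve_in_torus intro!: borel_measurable_continuous_onI continuous_torus_curve)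
  define L where "L n = distr (N n) borel curve_param" for n
  have L: "real_distribution (L n)" for n
    unfolding L_def by (intro prob_space.real_distribution_distr[OF prob] meas_s)
  have "tight L"
    unfolding tight_def
  proof (intro conjI allI impI L)
    fix e :: real assume "e > 0"
    have "measure (L n) {-1<..2} = 1" for n
    proof -
      have "curve_param -` {-1<..2} \<inter> space (N n) = space (N n)"
        using curve_param_mem(1) by (force simp: spaceN)
      then show ?thesis
        using prob_space.prob_space[OF prob, of n]
        by (simp add: L_def measure_distr[OF meas_s])
    qed
    then show "\<exists>a b. a < b \<and> (\<forall>n. 1 - e < measure (L n) {a<..b})"
      using \<open>e > 0\<close> by (intro exI[of _ "-1"] exI[of _ 2]) auto
  qed
  from tight_imp_convergent_subsubsequence[OF this strict_mono_id]
  obtain s L' where s: "strict_mono s" and L': "real_distribution L'"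
    and conv: "weak_conv_m (L \<circ> s) L'" by auto
  interpret L': real_distribution L' by fact
  define M where "M = distr L' ?T torus_curve"
  have meas_c': "torus_curve \<in> measurable L' ?T"
    using meas_c by (simp add: measurable_cong_sets[OF L'.events_eq_borel refl])
  have "converges_weakly_on_torus (N \<circ> s) M"
    unfolding converges_weakly_on_torus_def
  proof (intro allI impI)
    fix u :: "complex^'d \<Rightarrow> complex" assume u: "continuous_on torus u"
    have meas_u: "u \<in> borel_measurable ?T"
      by (rule borel_measurable_continuous_on_restrict[OF u])
    obtain B where B: "\<And>w. w \<in> torus \<Longrightarrow> norm (u w) \<le> B"
      using compact_imp_bounded[OF compact_continuous_image[OF u compact_torus]]
      by (auto simp: bounded_iff)
    let ?v = "\<lambda>t. u (torus_curve t)"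
    have cont: "continuous_on UNIV ?v"
      by (rule continuous_on_compose2[OF u continuous_torus_curve]) (auto simp: torus_curve_in_torus)
    have "(\<lambda>n. integral\<^sup>L ((L \<circ> s) n) ?v) \<longlonglongrightarrow> integral\<^sup>L L' ?v"
      by (rule weak_conv_imp_integral_bdd_continuous_conv[OF _ L' conv])
        (use L cont B[OF torus_curve_in_torus] in \<open>auto simp: continuous_on_eq_continuous_at\<close>)
    moreover have "integral\<^sup>L L' ?v = integral\<^sup>L M u"
      unfolding M_def by (rule integral_distr[OF meas_c' meas_u, symmetric])
    moreover have "integral\<^sup>L (L n) ?v = integral\<^sup>L (N n) u" for n
    proof -
      have "integral\<^sup>L (L n) ?v = integral\<^sup>L (N n) (\<lambda>w. ?v (curve_param w))"
        unfolding L_def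
        by (rule integral_distr[OF meas_s]) (rule borel_measurable_continuous_onI[OF cont])
      also have "\<dots> = integral\<^sup>L (N n) u"
        by (rule Bochner_Integration.integral_cong) (simp_all add: spaceN curve_param_mem)
      finally show ?thesis .
    qed
    ultimately show "(\<lambda>n. integral\<^sup>L ((N \<circ> s) n) u) \<longlonglongrightarrow> integral\<^sup>L M u"
      by simp
  qed
  moreover have "prob_space M"
    unfolding M_def by (rule L'.prob_space_distr[OF meas_c'])
  moreover have "sets M = sets ?T" by (simp add: M_def)
  ultimately show ?thesis using that s by blast
qed

section \<open>Density of the span of the Poisson kernels\<close>

text \<open>
  The Poisson kernel of the disc. The denominator is written as \<open>norm (1 - cnj z * w)\<close> instead of
  \<open>norm (w - z)\<close>: the two agree for \<open>norm w = 1\<close>, but for \<open>norm z < 1\<close> the first one does not vanish for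
  \<open>norm w \<le> 1\<close>, so that the kernel is continuous in \<open>w\<close> on the closed disc.
\<close>
definition circle_kernel :: "complex \<Rightarrow> complex \<Rightarrow> real" where
  "circle_kernel z w = (1 - (norm z)\<^sup>2) / (norm (1 - cnj z * w))\<^sup>2"

lemma one_minus_cnj_mult_nonzero:
  assumes "norm z < 1" "norm w \<le> 1"
  shows "1 - cnj z * w \<noteq> 0"
proof
  assume "1 - cnj z * w = 0"
  then have "norm (cnj z * w) = 1" by simp
  moreover have "norm (cnj z * w) \<le> norm z"
    using assms mult_left_le[of "norm w" "norm z"] by (simp add: norm_mult)
  ultimately show False using assms by simp
qed

lemma poisson_kernel_eq_prod_circle_kernel:
  assumes "w \<in> torus"
  shows "poisson_kernel z w = (\<Prod>j\<in>UNIV. circle_kernel (z $ j) (w $ j))"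
  unfolding poisson_kernel_def circle_kernel_def
proof (intro prod.cong refl arg_cong2[where f = "(/)"])
  fix j
  have w: "norm (w $ j) = 1" using assms by (simp add: torus_def)
  have w': "w $ j = cis (Arg (w $ j))"
    using rcis_cmod_Arg[of "w $ j"] w by (simp add: rcis_def)
  have z': "z $ j = norm (z $ j) * cis (Arg (z $ j))"
    using rcis_cmod_Arg[of "z $ j"] by (simp add: rcis_def)
  have "Re (cnj (z $ j) * w $ j) = norm (z $ j) * cos (Arg (z $ j) - Arg (w $ j))"
    by (subst z', subst w') (simp add: cos_diff algebra_simps)
  moreover have "(norm (1 - x))\<^sup>2 = 1 - 2 * Re x + (norm x)\<^sup>2" for x :: complex
    unfolding cmod_power2 by (simp add: power2_eq_square algebra_simps)
  ultimately show "1 - 2 * norm (z $ j) * cos (Arg (z $ j) - Arg (w $ j)) + (norm (z $ j))\<^sup>2 =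
      (norm (1 - cnj (z $ j) * w $ j))\<^sup>2"
    using w by (simp add: norm_mult)
qed

text \<open>
  For \<open>w\<close> on the circle the kernel is the real part of \<open>(1 + x) / (1 - x)\<close>. This is its expansion in powers of
  \<open>x\<close> and \<open>cnj x\<close> with an explicit remainder, from which the powers of \<open>w\<close> will be recovered one
  after the other.
\<close>
lemma circle_kernel_expansion:
  fixes z w :: complex
  defines "x \<equiv> cnj z * w"
  assumes "norm z < 1" "norm w = 1" "n > 0"
  shows "of_real (circle_kernel z w) =
    1 + (\<Sum>m=1..<n. x ^ m + cnj x ^ m) + (x ^ n / (1 - x) + cnj x ^ n / (1 - cnj x))"
proof -
  have x: "norm x = norm z" using assms by (simp add: norm_mult)
  have x1: "1 - x \<noteq> 0"
    unfolding x_def using one_minus_cnj_mult_nonzero[of z w] assms by simp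
  then have x1': "1 - cnj x \<noteq> 0"
    by (metis complex_cnj_cancel_iff complex_cnj_diff complex_cnj_one complex_cnj_zero)
  have partial_fractions: "(q + p - p * q) / (p * q) = 1/p + 1/q - 1" if "p \<noteq> 0" "q \<noteq> 0" for p q :: complex
    using that by (simp add: add_divide_distrib diff_divide_distrib)
  have "complex_of_real ((norm (1 - x))\<^sup>2) = (1 - x) * (1 - cnj x)"
    by (subst complex_norm_square) simp
  moreover have "complex_of_real ((norm x)\<^sup>2) = x * cnj x"
    by (rule complex_norm_square)
  ultimately have "of_real (circle_kernel z w) = (1 - x * cnj x) / ((1 - x) * (1 - cnj x))"
    unfolding circle_kernel_def x_def[symmetric] using x
    by (simp del: of_real_power)
  also have "1 - x * cnj x = (1 - cnj x) + (1 - x) - (1 - x) * (1 - cnj x)"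
    by (simp add: algebra_simps)
  also have "\<dots> / ((1 - x) * (1 - cnj x)) = 1/(1-x) + 1/(1 - cnj x) - 1"
    using x1 x1' by (rule partial_fractions)
  finally have K: "of_real (circle_kernel z w) = 1/(1-x) + 1/(1 - cnj x) - 1" .
  have geo: "1/(1-y) = 1 + (\<Sum>m=1..<Suc k. y ^ m) + y ^ Suc k / (1 - y)" if "1 - y \<noteq> 0" for y :: complex and k
    using that by (induction k) (auto simp: field_simps)
  obtain k where "n = Suc k" using \<open>n > 0\<close> gr0_implies_Suc by blast
  then show ?thesis
    unfolding K geo[OF x1, of k] geo[OF x1', of k] by (simp add: sum.distrib)
qed

lemma continuous_circle_kernel:
  assumes "norm z < 1"
  shows "continuous_on (torus :: (complex^'d::finite) set) (\<lambda>w. circle_kernel z (w $ j))"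
  unfolding circle_kernel_def
  using one_minus_cnj_mult_nonzero[OF assms]
  by (intro continuous_intros) (auto simp: torus_def)

text \<open>
  A space of functions on the torus that contains all Poisson kernels and is closed under linear
  combinations and uniform limits contains every continuous function (\<open>continuous_mem\<close> below). In the
  application it consists of the functions whose integrals converge along a given sequence of
  measures; that space is not obviously closed under products, so the Stone--Weierstrass theorem does not
  apply to it directly, and the trigonometric monomials have to be produced by hand.
\<close>
locale uniformly_closed_space =
  fixes V :: "(complex^'d::finite \<Rightarrow> complex) set"
  assumes add_mem: "u \<in> V \<Longrightarrow> v \<in> V \<Longrightarrow> (\<lambda>w. u w + v w) \<in> V"
    and scale_mem: "u \<in> V \<Longrightarrow> (\<lambda>w. c * u w) \<in> V"
    and limit_mem: "continuous_on torus u \<Longrightarrow>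
          (\<And>e. e > 0 \<Longrightarrow> \<exists>v\<in>V. \<forall>w\<in>torus. norm (u w - v w) \<le> e) \<Longrightarrow> u \<in> V"
    and poisson_mem: "z \<in> polydisc \<Longrightarrow> (\<lambda>w. of_real (poisson_kernel z w)) \<in> V"
begin

lemma cong_mem:
  assumes "v \<in> V" "continuous_on torus u" "\<And>w. w \<in> torus \<Longrightarrow> u w = v w"
  shows "u \<in> V"
  using assms by (intro limit_mem) (auto intro!: bexI[of _ v])

lemma sum_mem:
  assumes "finite A" "A \<noteq> {}" "\<And>a. a \<in> A \<Longrightarrow> u a \<in> V"
  shows "(\<lambda>w. \<Sum>a\<in>A. u a w) \<in> V"
  using assms
proof (induction A rule: finite_ne_induct)
  case (insert a A)
  then have "(\<lambda>w. u a w + (\<Sum>b\<in>A. u b w)) \<in> V" by (intro add_mem) auto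
  then show ?case using insert by simp
qed simp

text \<open>
  The powers of one coordinate are extracted from the Poisson kernels by induction. For
  \<open>z = t * \<zeta>\<close> with \<open>norm \<zeta> = 1\<close>, subtract from the kernel the terms of order less than \<open>n\<close>, which
  are known, divide by \<open>t ^ n\<close> and let \<open>t\<close> tend to 0: the uniform limit is \<open>x ^ n + cnj x ^ n\<close> with
  \<open>x = cnj \<zeta> * w $ i\<close>. Two choices of \<open>\<zeta>\<close> separate the two powers. The factor \<open>R\<close> carries the
  other coordinates.
\<close>
lemma power_times_mem:
  assumes R: "continuous_on torus R"
    and K: "\<And>z. norm z < 1 \<Longrightarrow> (\<lambda>w. of_real (circle_kernel z (w $ i)) * R w) \<in> V"
  shows "(\<lambda>w. (w $ i) ^ n * R w) \<in> V \<and> (\<lambda>w. cnj (w $ i) ^ n * R w) \<in> V"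
proof (induction n rule: less_induct)
  case (less n)
  have R_mem: "R \<in> V" using K[of 0] by (simp add: circle_kernel_def)
  show ?case
  proof (cases "n = 0")
    case True
    then show ?thesis using R_mem by simp
  next
    case False
    obtain B where B: "B > 0" "\<And>w. w \<in> torus \<Longrightarrow> norm (R w) \<le> B"
      using compact_imp_bounded[OF compact_continuous_image[OF R compact_torus]]
      by (auto simp: bounded_pos)
    have *: "(\<lambda>w. ((cnj \<zeta> * w $ i) ^ n + cnj (cnj \<zeta> * w $ i) ^ n) * R w) \<in> V" (is "?g \<in> V")
      if \<zeta>: "norm \<zeta> = 1" for \<zeta>
    proof (rule limit_mem)
      show "continuous_on torus ?g" by (intro continuous_intros R)
      fix e :: real assume "e > 0"
      \<comment> \<open>The remainder after the division is at most \<open>4 * t * B\<close> as soon as \<open>t \<le> 1/2\<close>.\<close>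
      define t where "t = min (1/2) (e / (4 * B))"
      have t: "0 < t" "t \<le> 1/2" "4 * B * t \<le> e"
        using B \<open>e > 0\<close> by (auto simp: t_def min_def field_simps)
      define x where "x = (\<lambda>w :: complex^'d. cnj \<zeta> * w $ i)"
      \<comment> \<open>The term of order 0 is subtracted as \<open>R w\<close>; the summand with \<open>m = 0\<close> only keeps the index set nonempty.\<close>
      define v where "v = (\<lambda>w. (1 / of_real t ^ n) * ((of_real (circle_kernel (of_real t * \<zeta>) (w $ i)) * R w) +
          (- 1) * ((R w) + (\<Sum>m\<in>{0..<n}. (if m = 0 then 0 else of_real t ^ m) *
              (((cnj \<zeta>) ^ m * ((w $ i) ^ m * R w)) + (\<zeta> ^ m * (cnj (w $ i) ^ m * R w)))))))"
      have "v \<in> V"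
        unfolding v_def
        by (intro scale_mem add_mem sum_mem K R_mem conjunct1[OF less] conjunct2[OF less])
          (use \<zeta> t False in \<open>auto simp: norm_mult\<close>)
      moreover have "norm (?g w - v w) \<le> e" if w: "w \<in> torus" for w
      proof -
        have nw: "norm (w $ i) = 1" using w by (simp add: torus_def)
        have nx: "norm (x w) = 1" using nw \<zeta> by (simp add: x_def norm_mult)
        let ?y = "of_real t * x w :: complex"
        have y: "cnj (of_real t * \<zeta>) * w $ i = ?y" by (simp add: x_def)
        have ny: "norm ?y = t" using nx t by (simp add: norm_mult)
        have sm: "(\<Sum>m\<in>{0..<n}. (if m = 0 then 0 else of_real t ^ m) *
              (((cnj \<zeta>) ^ m * ((w $ i) ^ m * R w)) + (\<zeta> ^ m * (cnj (w $ i) ^ m * R w)))) =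
            (\<Sum>m=1..<n. ?y ^ m + cnj ?y ^ m) * R w"
          unfolding sum_distrib_right
          by (rule sum.mono_neutral_cong_right)
            (auto simp: x_def power_mult_distrib algebra_simps)
        have "of_real (circle_kernel (of_real t * \<zeta>) (w $ i)) =
          1 + (\<Sum>m=1..<n. ?y ^ m + cnj ?y ^ m) + (?y ^ n / (1 - ?y) + cnj ?y ^ n / (1 - cnj ?y))"
          using circle_kernel_expansion[of "of_real t * \<zeta>" "w $ i" n, unfolded y] False \<zeta> nw t
          by (simp add: norm_mult)
        then have v: "v w = (1 / of_real t ^ n) * (?y ^ n / (1 - ?y) + cnj ?y ^ n / (1 - cnj ?y)) * R w"
          unfolding v_def sm by (simp add: algebra_simps)
        have y1: "1 - ?y \<noteq> 0" "1 - cnj ?y \<noteq> 0" and y2: "norm (1 - ?y) \<ge> 1/2" "norm (1 - cnj ?y) \<ge> 1/2"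
          using norm_triangle_ineq2[of 1 ?y] norm_triangle_ineq2[of 1 "cnj ?y"] ny t
          by (auto simp: complex_mod_cnj simp del: complex_cnj_mult)
        have tn: "of_real t ^ n \<noteq> (0::complex)" using t by simp
        have q: "(1 / of_real t ^ n) * ((of_real t * c) ^ n / (1 - of_real t * c)) =
            c ^ n + c ^ n * (of_real t * c) / (1 - of_real t * c)" if "1 - of_real t * c \<noteq> 0" for c :: complex
          using tn that by (simp add: power_mult_distrib) (simp add: field_simps)
        have "v w = ?g w + (x w ^ n * ?y / (1 - ?y) + cnj (x w) ^ n * cnj ?y / (1 - cnj ?y)) * R w"
          unfolding v distrib_left using q[of "x w"] q[of "cnj (x w)"] y1
          by (simp add: x_def distrib_left distrib_right)
        then have "norm (?g w - v w) =
            norm (x w ^ n * ?y / (1 - ?y) + cnj (x w) ^ n * cnj ?y / (1 - cnj ?y)) * norm (R w)"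
          by (simp add: norm_minus_commute norm_mult)
        also have "\<dots> \<le> (2 * t + 2 * t) * B"
        proof (rule mult_mono)
          have "norm (x w ^ n * ?y / (1 - ?y)) \<le> 2 * t"
            "norm (cnj (x w) ^ n * cnj ?y / (1 - cnj ?y)) \<le> 2 * t"
            using y2 nx t y1
            by (simp_all add: norm_divide norm_mult norm_power field_simps)
          then show "norm (x w ^ n * ?y / (1 - ?y) + cnj (x w) ^ n * cnj ?y / (1 - cnj ?y)) \<le> 2 * t + 2 * t"
            by (rule norm_triangle_mono)
        qed (use B w t in auto)
        also have "\<dots> \<le> e" using t by (simp add: algebra_simps)
        finally show ?thesis .
      qed
      ultimately show "\<exists>v\<in>V. \<forall>w\<in>torus. norm (?g w - v w) \<le> e" by blast
    qed
    \<comment> \<open>With this choice \<open>x ^ n + cnj x ^ n\<close> is \<open>\<i>\<close> times the difference of the two powers of \<open>w $ i\<close>.\<close>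
    define \<eta> where "\<eta> = cis (- pi / (2 * real n))"
    have \<eta>: "cnj \<eta> ^ n = \<i>" "\<eta> ^ n = - \<i>" "norm \<eta> = 1"
      using False by (simp_all add: \<eta>_def cis_cnj Complex.DeMoivre complex_eq_iff)
    have A: "(\<lambda>w. ((w $ i) ^ n + cnj (w $ i) ^ n) * R w) \<in> V"
      using *[of 1] by simp
    have B: "(\<lambda>w. (\<i> * (w $ i) ^ n - \<i> * cnj (w $ i) ^ n) * R w) \<in> V"
      using *[of \<eta>] \<eta> by (simp add: power_mult_distrib)
    have "(\<lambda>w. (1/2) * (((w $ i) ^ n + cnj (w $ i) ^ n) * R w) +
        (- \<i>/2) * ((\<i> * (w $ i) ^ n - \<i> * cnj (w $ i) ^ n) * R w)) \<in> V"
      "(\<lambda>w. (1/2) * (((w $ i) ^ n + cnj (w $ i) ^ n) * R w) +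
        (\<i>/2) * ((\<i> * (w $ i) ^ n - \<i> * cnj (w $ i) ^ n) * R w)) \<in> V"
      by (intro add_mem scale_mem A B)+
    then show ?thesis by (simp add: algebra_simps)
  qed
qed


lemma mixed_power_times_mem:
  assumes R: "continuous_on torus R"
    and K: "\<And>z. norm z < 1 \<Longrightarrow> (\<lambda>w. of_real (circle_kernel z (w $ i)) * R w) \<in> V"
  shows "(\<lambda>w. (w $ i) ^ a * cnj (w $ i) ^ b * R w) \<in> V"
proof -
  have cont: "continuous_on torus (\<lambda>w. (w $ i) ^ a * cnj (w $ i) ^ b * R w)"
    by (intro continuous_intros R)
  have one: "w $ i * cnj (w $ i) = 1" if "w \<in> torus" for w :: "complex^'d"
    using that complex_norm_square[of "w $ i"] by (simp add: torus_def)
  show ?thesis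
  proof (cases "b \<le> a")
    case True
    show ?thesis
    proof (rule cong_mem[OF conjunct1[OF power_times_mem[OF R K, where n = "a - b"]] cont])
      fix w :: "complex^'d" assume "w \<in> torus"
      have "(w $ i) ^ a * cnj (w $ i) ^ b = (w $ i) ^ (a - b) * (w $ i * cnj (w $ i)) ^ b"
        using power_add[of "w $ i" "a - b" b] True by (simp add: power_mult_distrib)
      then show "(w $ i) ^ a * cnj (w $ i) ^ b * R w = (w $ i) ^ (a - b) * R w"
        using one[OF \<open>w \<in> torus\<close>] by simp
    qed
  next
    case False
    show ?thesis
    proof (rule cong_mem[OF conjunct2[OF power_times_mem[OF R K, where n = "b - a"]] cont])
      fix w :: "complex^'d" assume "w \<in> torus"
      have "(w $ i) ^ a * cnj (w $ i) ^ b = cnj (w $ i) ^ (b - a) * (w $ i * cnj (w $ i)) ^ a"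
        using power_add[of "cnj (w $ i)" "b - a" a] False by (simp add: power_mult_distrib)
      then show "(w $ i) ^ a * cnj (w $ i) ^ b * R w = cnj (w $ i) ^ (b - a) * R w"
        using one[OF \<open>w \<in> torus\<close>] by simp
    qed
  qed
qed

text \<open>
  The Poisson kernel of the torus is a product over the coordinates, so its factors can be
  exchanged for monomials one at a time.
\<close>
lemma monomial_times_poisson_mem:
  assumes "finite I" "z \<in> polydisc"
  shows "(\<lambda>w. (\<Prod>j\<in>I. (w $ j) ^ a j * cnj (w $ j) ^ b j) *
      of_real (\<Prod>j\<in>-I. circle_kernel (z $ j) (w $ j))) \<in> V"
  using assms
proof (induction I arbitrary: z rule: finite_induct)
  case empty
  have "continuous_on torus (\<lambda>w. complex_of_real (\<Prod>j\<in>UNIV. circle_kernel (z $ j) (w $ j)))"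
    using empty by (intro continuous_intros continuous_circle_kernel) (auto simp: polydisc_def)
  then show ?case
    using cong_mem[OF poisson_mem[OF empty]] by (simp add: poisson_kernel_eq_prod_circle_kernel)
next
  case (insert i I)
  define R where "R w = (\<Prod>j\<in>I. (w $ j) ^ a j * cnj (w $ j) ^ b j) *
      complex_of_real (\<Prod>j\<in>-insert i I. circle_kernel (z $ j) (w $ j))" for w :: "complex^'d"
  have "continuous_on torus R"
    unfolding R_def using insert.prems
    by (intro continuous_intros continuous_circle_kernel) (auto simp: polydisc_def)
  moreover have "(\<lambda>w. of_real (circle_kernel \<zeta> (w $ i)) * R w) \<in> V" if "norm \<zeta> < 1" for \<zeta>
  proof -
    let ?z = "\<chi> j. if j = i then \<zeta> else z $ j"
    have "?z \<in> polydisc" using that insert.prems by (simp add: polydisc_def)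
    moreover have "- I = insert i (- insert i I)" using insert.hyps by auto
    then have "(\<Prod>j\<in>-I. circle_kernel (?z $ j) (w $ j)) =
        circle_kernel \<zeta> (w $ i) * (\<Prod>j\<in>-insert i I. circle_kernel (z $ j) (w $ j))" for w :: "complex^'d"
      by (auto intro!: prod.cong)
    ultimately show ?thesis
      using insert.IH[of ?z] by (simp add: R_def mult_ac)
  qed
  ultimately have "(\<lambda>w. (w $ i) ^ a i * cnj (w $ i) ^ b i * R w) \<in> V"
    by (rule mixed_power_times_mem)
  then show ?case using insert.hyps by (simp add: R_def mult_ac)
qed

lemma monomial_mem: "(\<lambda>w. (\<Prod>j\<in>UNIV. (w $ j) ^ a j * cnj (w $ j) ^ b j)) \<in> V"
  using monomial_times_poisson_mem[of UNIV 0 a b] by (simp add: polydisc_def)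

end

text \<open>
  Generated by monomials and sums only, because membership in a uniformly closed space passes through
  these two operations; closure under products is a lemma.
\<close>
inductive trig_poly :: "(complex^'d::finite \<Rightarrow> complex) \<Rightarrow> bool" where
  monomial: "trig_poly (\<lambda>w. c * (\<Prod>j\<in>UNIV. (w $ j) ^ a j * cnj (w $ j) ^ b j))"
| add: "trig_poly u \<Longrightarrow> trig_poly v \<Longrightarrow> trig_poly (\<lambda>w. u w + v w)"

lemma trig_poly_const: "trig_poly (\<lambda>w. c)"
  using trig_poly.monomial[of c "\<lambda>_. 0" "\<lambda>_. 0"] by simp

lemma trig_poly_mult:
  assumes "trig_poly u" "trig_poly v"
  shows "trig_poly (\<lambda>w. u w * v w)"
  using assms
proof (induction u)
  case (monomial c a b)
  show ?case using monomial
  proof (induction v)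
    case (monomial c' a' b')
    show ?case
      using trig_poly.monomial[of "c * c'" "\<lambda>j. a j + a' j" "\<lambda>j. b j + b' j"]
      by (simp add: power_add prod.distrib mult_ac)
  next
    case (add u v)
    show ?case using trig_poly.add[OF add.IH] by (simp add: distrib_left)
  qed
next
  case (add u v)
  show ?case using trig_poly.add[OF add.IH] add.prems by (simp add: distrib_right)
qed

lemma trig_poly_sum:
  assumes "finite A" "\<And>a. a \<in> A \<Longrightarrow> trig_poly (u a)"
  shows "trig_poly (\<lambda>w. \<Sum>a\<in>A. u a w)"
  using assms by (induction A rule: finite_induct) (auto intro: trig_poly_const trig_poly.add)

lemma trig_poly_coordinate: "trig_poly (\<lambda>w. w $ i)" "trig_poly (\<lambda>w. cnj (w $ i))"
proof -
  have *: "(\<Prod>j\<in>UNIV. f j ^ (if j = i then 1 else 0)) = f i" for f :: "'b::finite \<Rightarrow> complex" and i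
    by (subst prod.remove[of _ i]) (auto intro!: prod.neutral)
  show "trig_poly (\<lambda>w. w $ i)"
    using trig_poly.monomial[of 1 "\<lambda>j. if j = i then 1 else 0" "\<lambda>_. 0"] by (simp only: * power_0 mult_1_left mult_1_right)
  show "trig_poly (\<lambda>w. cnj (w $ i))"
    using trig_poly.monomial[of 1 "\<lambda>_. 0" "\<lambda>j. if j = i then 1 else 0"] by (simp only: * power_0 mult_1_left mult_1_right)
qed

lemma trig_poly_of_real_polynomial:
  fixes g :: "complex^'d::finite \<Rightarrow> real"
  assumes "real_polynomial_function g"
  shows "trig_poly (\<lambda>w. of_real (g w))"
  using assms
proof induction
  case (linear g)
  interpret bounded_linear g by fact
  have Re_part: "complex_of_real (Re c) = (1/2) * (c + cnj c)"
    and Im_part: "complex_of_real (Im c) = (- \<i>/2) * (c + (- 1) * cnj c)" for c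
    by (auto simp: complex_eq_iff)
  have inner: "trig_poly (\<lambda>w :: complex^'d. of_real (w \<bullet> b))" if b: "b \<in> Basis" for b
  proof -
    from b obtain j c where b: "b = axis j c" "c = 1 \<or> c = \<i>"
      by (auto simp: Basis_vec_def Basis_complex_def)
    have re: "trig_poly (\<lambda>w :: complex^'d. (1/2) * (w $ j + cnj (w $ j)))"
      and im: "trig_poly (\<lambda>w :: complex^'d. (- \<i>/2) * (w $ j + (- 1) * cnj (w $ j)))"
      by (intro trig_poly_mult trig_poly.add trig_poly_coordinate trig_poly_const)+
    have "(\<lambda>w :: complex^'d. complex_of_real (w \<bullet> axis j 1)) = (\<lambda>w. (1/2) * (w $ j + cnj (w $ j)))"
      "(\<lambda>w :: complex^'d. complex_of_real (w \<bullet> axis j \<i>)) = (\<lambda>w. (- \<i>/2) * (w $ j + (- 1) * cnj (w $ j)))"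
      by (auto simp: inner_axis inner_complex_def Re_part Im_part)
    then show ?thesis using b re im by auto
  qed
  have g_eq: "g w = (\<Sum>b\<in>Basis. (w \<bullet> b) * g b)" for w
  proof -
    have "g w = g (\<Sum>b\<in>Basis. (w \<bullet> b) *\<^sub>R b)" by (simp only: euclidean_representation)
    also have "\<dots> = (\<Sum>b\<in>Basis. (w \<bullet> b) * g b)" by (simp only: sum scaleR real_scaleR_def)
    finally show ?thesis .
  qed
  have "(\<lambda>w. complex_of_real (g w)) = (\<lambda>w. \<Sum>b\<in>Basis. of_real (w \<bullet> b) * of_real (g b))"
    by (rule ext, subst g_eq) (simp only: of_real_sum of_real_mult)
  moreover have "trig_poly (\<lambda>w. \<Sum>b\<in>Basis. complex_of_real (w \<bullet> b) * of_real (g b))"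
    by (rule trig_poly_sum, simp, rule trig_poly_mult, erule inner, rule trig_poly_const)
  ultimately show ?case by simp
next
  case (const c)
  show ?case by (rule trig_poly_const)
next
  case (add f g)
  show ?case using trig_poly.add[OF add.IH] by simp
next
  case (mult f g)
  show ?case using trig_poly_mult[OF mult.IH] by simp
qed

lemma (in uniformly_closed_space) trig_poly_mem: "trig_poly u \<Longrightarrow> u \<in> V"
  by (induction rule: trig_poly.induct) (auto intro: scale_mem add_mem monomial_mem)

text \<open>
  Polynomials in the real and imaginary parts of the coordinates are trigonometric polynomials, and they
  are dense by the Stone--Weierstrass theorem.
\<close>
theorem (in uniformly_closed_space) continuous_mem:
  assumes u: "continuous_on torus u"
  shows "u \<in> V"
proof (rule limit_mem[OF u])
  fix e :: real assume "e > 0"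
  from Stone_Weierstrass_polynomial_function[OF compact_torus u this]
  obtain g where g: "polynomial_function g" "\<And>w. w \<in> torus \<Longrightarrow> norm (u w - g w) < e" by blast
  have "real_polynomial_function (\<lambda>w. Re (g w))" "real_polynomial_function (\<lambda>w. Im (g w))"
    using g(1) bounded_linear_Re bounded_linear_Im
    unfolding polynomial_function_def o_def by blast+
  then have "trig_poly (\<lambda>w. of_real (Re (g w)) + \<i> * of_real (Im (g w)))"
    by (intro trig_poly.add trig_poly_mult trig_poly_const trig_poly_of_real_polynomial)
  moreover have "(\<lambda>w. of_real (Re (g w)) + \<i> * of_real (Im (g w))) = g"
    by (simp flip: complex_eq)
  ultimately have "g \<in> V" using trig_poly_mem by simp
  then show "\<exists>v\<in>V. \<forall>w\<in>torus. norm (u w - v w) \<le> e"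
    using g(2) by (intro bexI[of _ g]) (auto intro: less_imp_le)
qed

section \<open>Measures are determined by their Poisson integrals\<close>

lemma space_torus_measure:
  "sets M = sets (restrict_space borel torus) \<Longrightarrow> space M = torus"
  by (drule sets_eq_imp_space_eq) (simp add: space_restrict_space)

lemma continuous_torus_measurable:
  fixes u :: "complex^'d::finite \<Rightarrow> 'b::topological_space"
  assumes "sets M = sets (restrict_space borel torus)" "continuous_on torus u"
  shows "u \<in> borel_measurable M"
  using borel_measurable_continuous_on_restrict[OF assms(2)]
  by (simp add: measurable_cong_sets[OF assms(1) refl])

lemma continuous_torus_bounded:
  fixes u :: "complex^'d::finite \<Rightarrow> 'b::real_normed_vector"
  assumes "continuous_on torus u"
  obtains B where "B > 0" "\<And>w. w \<in> torus \<Longrightarrow> norm (u w) \<le> B"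
  using compact_imp_bounded[OF compact_continuous_image[OF assms compact_torus]]
  by (auto simp: bounded_pos)

lemma continuous_torus_integrable:
  fixes u :: "complex^'d::finite \<Rightarrow> 'b::{banach, second_countable_topology}"
  assumes "finite_measure M" "sets M = sets (restrict_space borel torus)" "continuous_on torus u"
  shows "integrable M u"
proof -
  obtain B where "\<And>w. w \<in> torus \<Longrightarrow> norm (u w) \<le> B"
    using continuous_torus_bounded[OF assms(3)] by blast
  then show ?thesis
    using space_torus_measure[OF assms(2)]
    by (intro finite_measure.integrable_const_bound[OF assms(1), of _ B]
        continuous_torus_measurable assms) auto
qed

lemma continuous_poisson_kernel:
  assumes "z \<in> polydisc"
  shows "continuous_on torus (poisson_kernel z)"
proof -
  have "continuous_on torus (\<lambda>w. \<Prod>j\<in>UNIV. circle_kernel (z $ j) (w $ j))"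
    using assms by (intro continuous_intros continuous_circle_kernel) (auto simp: polydisc_def)
  then show ?thesis
    by (rule continuous_on_eq) (simp add: poisson_kernel_eq_prod_circle_kernel)
qed

lemma poisson_kernel_0: "poisson_kernel 0 w = 1"
  by (simp add: poisson_kernel_def)

lemma zero_in_polydisc: "0 \<in> polydisc"
  by (simp add: polydisc_def)

text \<open>
  The continuous functions whose integrals converge form a uniformly closed space: the masses, being the
  Poisson integrals at 0, are bounded.
\<close>
theorem weak_convergence_from_poisson_integrals:
  fixes N :: "nat \<Rightarrow> (complex^'d::finite) measure"
  assumes fin: "\<And>n. finite_measure (N n)" "finite_measure M"
    and sets: "\<And>n. sets (N n) = sets (restrict_space borel torus)"
      "sets M = sets (restrict_space borel torus)"
    and lim: "\<And>z. z \<in> polydisc \<Longrightarrow>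
      (\<lambda>n. integral\<^sup>L (N n) (poisson_kernel z)) \<longlonglongrightarrow> integral\<^sup>L M (poisson_kernel z)"
  shows "converges_weakly_on_torus N M"
proof -
  note intN = continuous_torus_integrable[OF fin(1) sets(1)]
    and intM = continuous_torus_integrable[OF fin(2) sets(2)]
  define mass where "mass L = measure L (space L)" for L :: "(complex^'d) measure"
  have "(\<lambda>n. mass (N n)) \<longlonglongrightarrow> mass M"
    using lim[OF zero_in_polydisc] by (simp add: poisson_kernel_0[abs_def] mass_def)
  then have "Bseq (\<lambda>n. mass (N n))"
    by (intro convergent_imp_Bseq convergentI)
  then obtain C where C: "C > 0" "\<And>n. mass (N n) \<le> C"
    unfolding Bseq_def by (metis abs_le_D1 real_norm_def)
  define C' where "C' = max C (mass M)"
  have C': "C' > 0" "mass (N n) \<le> C'" "mass M \<le> C'" for n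
    using C(1) C(2)[of n] by (auto simp: C'_def)
  have close: "norm (integral\<^sup>L L u - integral\<^sup>L L v) \<le> e * C'"
    if "\<forall>w\<in>torus. norm (u w - v w) \<le> e" "integrable L u" "integrable L v" "space L = torus"
      "mass L \<le> C'" "e > 0" "finite_measure L"
    for L :: "(complex^'d) measure" and u v :: "complex^'d \<Rightarrow> complex" and e
  proof -
    interpret finite_measure L by fact
    have "norm (integral\<^sup>L L u - integral\<^sup>L L v) = norm (integral\<^sup>L L (\<lambda>w. u w - v w))"
      using that by simp
    also have "\<dots> \<le> integral\<^sup>L L (\<lambda>w. e)"
      by (rule Bochner_Integration.integral_norm_bound_integral) (use that in auto)
    also have "\<dots> = e * mass L" by (simp add: mass_def)
    also have "\<dots> \<le> e * C'" using that by (intro mult_left_mono) auto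
    finally show ?thesis .
  qed
  define V where "V = {u :: complex^'d \<Rightarrow> complex. continuous_on torus u \<and>
      (\<lambda>n. integral\<^sup>L (N n) u) \<longlonglongrightarrow> integral\<^sup>L M u}"
  interpret uniformly_closed_space V
  proof
    fix u v assume "u \<in> V" "v \<in> V"
    then show "(\<lambda>w. u w + v w) \<in> V"
      by (auto simp: V_def intN intM intro!: continuous_intros tendsto_add)
  next
    fix u c assume "u \<in> V"
    then show "(\<lambda>w. c * u w) \<in> V"
      by (auto simp: V_def intro!: continuous_intros tendsto_mult)
  next
    fix z :: "complex^'d" assume "z \<in> polydisc"
    then show "(\<lambda>w. of_real (poisson_kernel z w)) \<in> V"
      using lim continuous_poisson_kernel
      by (auto simp: V_def intro!: continuous_intros tendsto_of_real)
  next
    fix u assume u: "continuous_on torus u"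
      and approx: "\<And>e. e > 0 \<Longrightarrow> \<exists>v\<in>V. \<forall>w\<in>torus. norm (u w - v w) \<le> e"
    have "(\<lambda>n. integral\<^sup>L (N n) u) \<longlonglongrightarrow> integral\<^sup>L M u"
    proof (rule LIMSEQ_I)
      fix e :: real assume "e > 0"
      define d where "d = e / (3 * C')"
      have d: "d > 0" "d * C' = e / 3" using \<open>e > 0\<close> C' by (auto simp: d_def)
      obtain v where v: "v \<in> V" "\<forall>w\<in>torus. norm (u w - v w) \<le> d"
        using approx[OF d(1)] by blast
      then have vc: "continuous_on torus v" by (simp add: V_def)
      obtain n0 where n0: "\<And>n. n \<ge> n0 \<Longrightarrow> norm (integral\<^sup>L (N n) v - integral\<^sup>L M v) < e / 3"
        using LIMSEQ_D[of "\<lambda>n. integral\<^sup>L (N n) v" "integral\<^sup>L M v" "e/3"] v(1) \<open>e > 0\<close>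
        by (auto simp: V_def)
      have "norm (integral\<^sup>L (N n) u - integral\<^sup>L M u) < e" if "n \<ge> n0" for n
      proof -
        have "norm (integral\<^sup>L (N n) u - integral\<^sup>L (N n) v) \<le> e / 3"
          using close[OF v(2) intN[OF u] intN[OF vc] space_torus_measure[OF sets(1)] C'(2) d(1) fin(1)]
          by (simp add: d(2))
        moreover have "norm (integral\<^sup>L M u - integral\<^sup>L M v) \<le> e / 3"
          using close[OF v(2) intM[OF u] intM[OF vc] space_torus_measure[OF sets(2)] C'(3) d(1) fin(2)]
          by (simp add: d(2))
        moreover have "norm (integral\<^sup>L (N n) v - integral\<^sup>L M v) < e / 3"
          by (rule n0[OF that])
        moreover have triangle: "norm (p - q) \<le> norm (p - p') + norm (q - q') + norm (p' - q')" for p q p' q' :: complex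
          using norm_triangle_ineq[of "(p - p') - (q - q')" "p' - q'"] norm_triangle_ineq4[of "p - p'" "q - q'"]
          by simp
        ultimately show ?thesis
          using triangle[of "integral\<^sup>L (N n) u" "integral\<^sup>L M u" "integral\<^sup>L (N n) v" "integral\<^sup>L M v"]
          by linarith
      qed
      then show "\<exists>n0. \<forall>n\<ge>n0. norm (integral\<^sup>L (N n) u - integral\<^sup>L M u) < e" by blast
    qed
    with u show "u \<in> V" by (simp add: V_def)
  qed
  show ?thesis
    using continuous_mem by (auto simp: converges_weakly_on_torus_def V_def)
qed

text \<open>
  The indicator function of a closed set \<open>C\<close> is the limit of the continuous functions
  \<open>max 0 (1 - n * infdist w C)\<close>, and closed sets generate the Borel sets. The generator argument is
  carried out for the images of the measures on the whole space.
\<close>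
lemma torus_measure_eqI:
  fixes M N :: "(complex^'d::finite) measure"
  assumes fin: "finite_measure M" "finite_measure N"
    and sets: "sets M = sets (restrict_space borel torus)" "sets N = sets (restrict_space borel torus)"
    and eq: "\<And>u :: complex^'d \<Rightarrow> complex. continuous_on torus u \<Longrightarrow> integral\<^sup>L M u = integral\<^sup>L N u"
  shows "M = N"
proof -
  have meas: "(\<lambda>x. x) \<in> measurable L borel" if "sets L = sets (restrict_space borel torus)"
    for L :: "(complex^'d) measure"
    using continuous_torus_measurable[OF that continuous_on_id] .
  have closed_lim: "(\<lambda>n. integral\<^sup>L L (\<lambda>w. complex_of_real (max 0 (1 - real n * infdist w C))))
      \<longlonglongrightarrow> of_real (measure L (C \<inter> torus))"
    if "finite_measure L" "sets L = sets (restrict_space borel torus)" "closed C" "C \<noteq> {}"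
    for L :: "(complex^'d) measure" and C
  proof -
    interpret finite_measure L by fact
    have sp: "space L = torus" by (rule space_torus_measure[OF that(2)])
    have CL: "C \<inter> torus \<in> sets L"
      using that by (auto simp: sets_restrict_space intro!: image_eqI[of _ _ C])
    have "(\<lambda>n. integral\<^sup>L L (\<lambda>w. complex_of_real (max 0 (1 - real n * infdist w C))))
        \<longlonglongrightarrow> integral\<^sup>L L (\<lambda>w. of_real (indicator (C \<inter> torus) w))"
    proof (rule integral_dominated_convergence[where w = "\<lambda>_. 1"])
      show "(\<lambda>w. complex_of_real (indicator (C \<inter> torus) w)) \<in> borel_measurable L"
        using CL by measurable
      show "(\<lambda>w. complex_of_real (max 0 (1 - real n * infdist w C))) \<in> borel_measurable L" for n
        by (intro continuous_torus_measurable that continuous_intros)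
      show "AE w in L. (\<lambda>n. complex_of_real (max 0 (1 - real n * infdist w C)))
          \<longlonglongrightarrow> of_real (indicator (C \<inter> torus) w)"
      proof (intro AE_I2 tendsto_of_real)
        fix w assume w: "w \<in> space L"
        show "(\<lambda>n. max 0 (1 - real n * infdist w C)) \<longlonglongrightarrow> indicator (C \<inter> torus) w"
        proof (cases "w \<in> C")
          case True
          then show ?thesis using w sp by simp
        next
          case False
          then have pos: "infdist w C > 0"
            using that(3,4) in_closed_iff_infdist_zero[of C w] infdist_nonneg[of w C] by linarith
          obtain n0 :: nat where n0: "1 / infdist w C < real n0" using reals_Archimedean2 by blast
          have "max 0 (1 - real n * infdist w C) = 0" if "n \<ge> n0" for n
          proof -
            have "1 < real n0 * infdist w C" using n0 pos by (simp add: field_simps)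
            also have "\<dots> \<le> real n * infdist w C" using that pos by (intro mult_right_mono) auto
            finally show ?thesis by simp
          qed
          then show ?thesis
            using False by (intro tendsto_eventually) (auto simp: eventually_sequentially)
        qed
      qed
      show "AE w in L. norm (complex_of_real (max 0 (1 - real n * infdist w C))) \<le> 1" for n
        by (auto simp: infdist_nonneg)
    qed simp
    also have "integral\<^sup>L L (\<lambda>w. complex_of_real (indicator (C \<inter> torus) w)) =
        of_real (measure L (C \<inter> torus))"
      using CL sp by (simp only: integral_complex_of_real integral_indicator) (simp add: Int_absorb1 Int_assoc)
    finally show ?thesis .
  qed
  have "distr M borel (\<lambda>x. x) = distr N borel (\<lambda>x. x)"
  proof (rule measure_eqI_generator_eq[where \<Omega> = UNIV and E = "Collect closed" and A = "\<lambda>_. UNIV"])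
    show "Int_stable (Collect closed)" by (auto simp: Int_stable_def)
    show "sets (distr M borel (\<lambda>x. x)) = sigma_sets UNIV (Collect closed)"
      "sets (distr N borel (\<lambda>x. x)) = sigma_sets UNIV (Collect closed)"
      by (simp_all add: borel_eq_closed)
    show "emeasure (distr M borel (\<lambda>x. x)) UNIV \<noteq> \<infinity>"
      using finite_measure.emeasure_finite[OF fin(1)] by (simp add: emeasure_distr meas sets)
    fix C :: "(complex^'d) set" assume "C \<in> Collect closed"
    then have C: "closed C" by simp
    have "measure M (C \<inter> torus) = measure N (C \<inter> torus)"
    proof (cases "C = {}")
      case False
      have "integral\<^sup>L M (\<lambda>w. complex_of_real (max 0 (1 - real n * infdist w C))) =
          integral\<^sup>L N (\<lambda>w. complex_of_real (max 0 (1 - real n * infdist w C)))" for n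
        by (intro eq continuous_intros)
      then have "complex_of_real (measure M (C \<inter> torus)) = of_real (measure N (C \<inter> torus))"
        using closed_lim[OF fin(1) sets(1) C False] closed_lim[OF fin(2) sets(2) C False]
        by (simp only: LIMSEQ_unique)
      then show ?thesis by simp
    qed simp
    then show "emeasure (distr M borel (\<lambda>x. x)) C = emeasure (distr N borel (\<lambda>x. x)) C"
      using C fin sets
      by (simp add: emeasure_distr meas space_torus_measure finite_measure.emeasure_eq_measure)
  qed auto
  then have eq: "emeasure (distr M borel (\<lambda>x. x)) A = emeasure (distr N borel (\<lambda>x. x)) A" for A
    by simp
  show ?thesis
  proof (rule measure_eqI)
    show "sets M = sets N" using sets by simp
    fix A assume A: "A \<in> sets M"
    then have "A \<in> sets borel" "A \<subseteq> torus"
      using torus_in_borel sets by (auto simp: sets_restrict_space)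
    then show "emeasure M A = emeasure N A"
      using eq[of A] sets by (simp add: emeasure_distr meas space_torus_measure Int_absorb2)
  qed
qed

text \<open>
  The kernel at the point 0 is the constant 1.
\<close>
lemma represents_on_torus_finite:
  assumes "represents_on_torus M h"
  shows "finite_measure M"
proof -
  have "has_bochner_integral M (poisson_kernel 0) (Re ((1 + h 0) / (1 - h 0)))"
    using assms zero_in_polydisc by (auto simp: represents_on_torus_def)
  then have "integrable M (\<lambda>_. 1 :: real)"
    by (simp add: poisson_kernel_0[abs_def] has_bochner_integral_iff)
  then show ?thesis
    by (auto simp: integrable_iff_bounded intro!: finite_measureI)
qed

text \<open>
  Uniqueness of the representing measure is the convergence criterion for a constant sequence.
\<close>
lemma mu_eqI:
  fixes M :: "(complex^'d::finite) measure"
  assumes M: "represents_on_torus M h"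
  shows "mu h = M"
  unfolding mu_def
proof (rule the_equality[where P = "\<lambda>M. represents_on_torus M h", OF M])
  fix N assume N: "represents_on_torus N h"
  have int: "integral\<^sup>L N (poisson_kernel z) = integral\<^sup>L M (poisson_kernel z)" if "z \<in> polydisc" for z
    using M N that by (auto simp: represents_on_torus_def has_bochner_integral_iff)
  have conv: "converges_weakly_on_torus (\<lambda>_. N) M"
    using M N int
    by (intro weak_convergence_from_poisson_integrals represents_on_torus_finite)
      (auto simp: represents_on_torus_def)
  show "N = M"
  proof (rule torus_measure_eqI)
    fix u :: "complex^'d \<Rightarrow> complex" assume "continuous_on torus u"
    then show "integral\<^sup>L N u = integral\<^sup>L M u"
      using conv LIMSEQ_unique[OF tendsto_const] by (auto simp: converges_weakly_on_torus_def)
  qed (use M N represents_on_torus_finite in \<open>auto simp: represents_on_torus_def\<close>)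
qed

section \<open>The polydisc algebra and the Poisson formula\<close>

definition closed_polydisc :: "(complex^'d::finite) set" where
  "closed_polydisc = {z. \<forall>j. norm (z $ j) \<le> 1}"

text \<open>
  Functions that are continuous on the closed polydisc and holomorphic in each variable separately,
  also when the other variables lie on the boundary. This is what an iterated use of Cauchy's
  formula needs, and it is preserved by division by functions without zeros on the closed polydisc.
\<close>
definition polydisc_algebra :: "(complex^'d::finite \<Rightarrow> complex) set" where
  "polydisc_algebra = {G. continuous_on closed_polydisc G \<and>
     (\<forall>z\<in>closed_polydisc. \<forall>i. (\<lambda>t. G (\<chi> j. if j = i then t else z $ j)) holomorphic_on ball 0 1)}"

lemma polydisc_subset: "polydisc \<subseteq> closed_polydisc"
  by (auto simp: polydisc_def closed_polydisc_def less_imp_le)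

lemma torus_subset: "torus \<subseteq> closed_polydisc"
  by (auto simp: torus_def closed_polydisc_def)

lemma polydisc_algebra_const: "(\<lambda>_. c) \<in> polydisc_algebra"
  by (simp add: polydisc_algebra_def)

lemma polydisc_algebra_coordinate: "(\<lambda>z. z $ i) \<in> polydisc_algebra"
proof -
  have "(\<lambda>t. if i = j then t else z $ i) holomorphic_on ball 0 1" for j and z :: "complex^'a"
    by (cases "i = j") auto
  then show ?thesis by (auto simp: polydisc_algebra_def intro!: continuous_intros)
qed

lemma polydisc_algebra_add:
  "F \<in> polydisc_algebra \<Longrightarrow> G \<in> polydisc_algebra \<Longrightarrow> (\<lambda>z. F z + G z) \<in> polydisc_algebra"
  by (auto simp: polydisc_algebra_def intro!: continuous_intros holomorphic_intros)

lemma polydisc_algebra_diff: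
  "F \<in> polydisc_algebra \<Longrightarrow> G \<in> polydisc_algebra \<Longrightarrow> (\<lambda>z. F z - G z) \<in> polydisc_algebra"
  by (auto simp: polydisc_algebra_def intro!: continuous_intros holomorphic_intros)

lemma polydisc_algebra_mult:
  "F \<in> polydisc_algebra \<Longrightarrow> G \<in> polydisc_algebra \<Longrightarrow> (\<lambda>z. F z * G z) \<in> polydisc_algebra"
  by (auto simp: polydisc_algebra_def intro!: continuous_intros holomorphic_intros)

lemma polydisc_algebra_divide:
  assumes "F \<in> polydisc_algebra" "G \<in> polydisc_algebra" "\<And>z. z \<in> closed_polydisc \<Longrightarrow> G z \<noteq> 0"
  shows "(\<lambda>z. F z / G z) \<in> polydisc_algebra"
proof -
  have "(\<chi> j. if j = i then t else z $ j) \<in> closed_polydisc"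
    if "z \<in> closed_polydisc" "t \<in> ball 0 1" for z :: "complex^'a" and i t
    using that by (auto simp: closed_polydisc_def)
  then show ?thesis
    using assms by (auto simp: polydisc_algebra_def intro!: continuous_intros holomorphic_intros)
qed

lemma polydisc_algebra_prod:
  "finite I \<Longrightarrow> (\<And>i. i \<in> I \<Longrightarrow> F i \<in> polydisc_algebra) \<Longrightarrow> (\<lambda>z. \<Prod>i\<in>I. F i z) \<in> polydisc_algebra"
  by (induction I rule: finite_induct) (auto intro: polydisc_algebra_const polydisc_algebra_mult)

lemmas polydisc_algebra_intros = polydisc_algebra_const polydisc_algebra_coordinate
  polydisc_algebra_add polydisc_algebra_diff polydisc_algebra_mult polydisc_algebra_divide
  polydisc_algebra_prod

definition unit_interval_measure :: "real measure" where
  "unit_interval_measure = density lborel (indicator {0..1})"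

lemma sets_unit_interval_measure [simp, measurable_cong]: "sets unit_interval_measure = sets borel"
  by (simp add: unit_interval_measure_def)

lemma space_unit_interval_measure [simp]: "space unit_interval_measure = UNIV"
  by (simp add: unit_interval_measure_def)

lemma prob_space_unit_interval_measure: "prob_space unit_interval_measure"
  by (rule prob_spaceI) (simp add: unit_interval_measure_def emeasure_density)

lemma integral_unit_interval_measure:
  fixes f :: "real \<Rightarrow> 'a::euclidean_space"
  assumes "continuous_on UNIV f"
  shows "integral\<^sup>L unit_interval_measure f = integral {0..1} f"
proof -
  have "integral\<^sup>L unit_interval_measure f = integral\<^sup>L lborel (\<lambda>x. indicator {0..1} x *\<^sub>R f x)"
    unfolding unit_interval_measure_def
    using integral_density[of f lborel "indicator {0..1} :: real \<Rightarrow> real"]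
      borel_measurable_continuous_onI[OF assms]
    by (simp add: ennreal_indicator)
  also have "\<dots> = integral {0..1} f"
    using set_borel_integral_eq_integral(2)[of "{0..1}" f]
      borel_integrable_atLeastAtMost'[OF continuous_on_subset[OF assms]]
    by (simp add: set_lebesgue_integral_def)
  finally show ?thesis .
qed

text \<open>
  For \<open>w\<close> on the circle \<open>w / (w - z) = 1 / (1 - z * cnj w)\<close>. Hence the integral is the Cauchy integral
  at \<open>z\<close> of \<open>g w * (1 - z * cnj z) / (1 - cnj z * w)\<close>, whose value at \<open>z\<close> is \<open>g z\<close>.
\<close>
lemma poisson_formula_circle:
  assumes contg: "continuous_on (cball 0 1) g" and holg: "g holomorphic_on ball 0 1"
    and z: "norm z < 1"
  shows "integral\<^sup>L unit_interval_measure
    (\<lambda>t. of_real (circle_kernel z (cis (2 * pi * t))) * g (cis (2 * pi * t))) = g z"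
proof -
  define c where "c = (\<lambda>t. cis (2 * pi * t))"
  define L where "L = (\<lambda>w. g w * (1 - z * cnj z) / (1 - cnj z * w))"
  have nz: "1 - cnj z * w \<noteq> 0" if "norm w \<le> 1" for w
    by (rule one_minus_cnj_mult_nonzero[OF z that])
  have "((\<lambda>u. L u / (u - z)) has_contour_integral (2 * of_real pi * \<i> * L z)) (circlepath 0 1)"
    by (rule Cauchy_integral_circlepath)
      (use nz z in \<open>auto simp: L_def intro!: continuous_intros holomorphic_intros contg holg\<close>)
  moreover have "L z = g z" using nz[of z] z by (simp add: L_def mult.commute)
  ultimately have contour: "((\<lambda>t. L (circlepath 0 1 t) / (circlepath 0 1 t - z) *
      vector_derivative (circlepath 0 1) (at t within {0..1})) has_integral
      (2 * of_real pi * \<i> * g z)) {0..1}"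
    by (simp add: has_contour_integral_def)
  have integrand: "L (circlepath 0 1 t) / (circlepath 0 1 t - z) *
      vector_derivative (circlepath 0 1) (at t within {0..1}) =
      2 * of_real pi * \<i> * (of_real (circle_kernel z (c t)) * g (c t))" if "t \<in> {0..1}" for t
  proof -
    have ct: "circlepath 0 1 t = c t" "exp (2 * of_real pi * \<i> * of_real t) = c t"
      by (simp_all add: circlepath c_def cis_conv_exp mult_ac)
    have nc: "norm (c t) = 1" by (simp add: c_def)
    have cc: "c t * cnj (c t) = 1" by (simp add: c_def cis_cnj cis_mult)
    have cz: "c t - z = c t * cnj (1 - cnj z * c t)"
      using cc by (simp add: algebra_simps)
    have K: "complex_of_real (circle_kernel z (c t)) =
        (1 - z * cnj z) / ((1 - cnj z * c t) * cnj (1 - cnj z * c t))"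
      unfolding circle_kernel_def by (simp only: of_real_divide of_real_diff of_real_1 complex_norm_square)
    have c0: "c t \<noteq> 0" using nc by auto
    show ?thesis
      using vector_derivative_circlepath01[of t 0 1] that
      unfolding ct L_def K by (simp add: cz c0 ct del: complex_cnj_diff complex_cnj_mult)
  qed
  have "((\<lambda>t. 2 * of_real pi * \<i> * (of_real (circle_kernel z (c t)) * g (c t)))
      has_integral (2 * of_real pi * \<i> * g z)) {0..1}"
    by (rule has_integral_eq[OF integrand contour])
  from has_integral_mult_right[OF this, of "1 / (2 * of_real pi * \<i>)"]
  have "((\<lambda>t. of_real (circle_kernel z (c t)) * g (c t)) has_integral g z) {0..1}"
    by simp
  then have "integral {0..1} (\<lambda>t. of_real (circle_kernel z (c t)) * g (c t)) = g z"
    by (rule integral_unique)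
  moreover have "continuous_on UNIV (\<lambda>t. of_real (circle_kernel z (c t)) * g (c t))"
  proof -
    have "continuous_on UNIV c" unfolding c_def by (intro continuous_intros continuous_on_compose2[OF continuous_on_cis]) auto
    moreover have "continuous_on UNIV (\<lambda>t. g (c t))"
      by (rule continuous_on_compose2[OF contg calculation]) (auto simp: c_def)
    ultimately show ?thesis
      unfolding circle_kernel_def using nz by (intro continuous_intros) (auto simp: c_def)
  qed
  ultimately show ?thesis
    by (simp add: c_def integral_unit_interval_measure)
qed

text \<open>
  The point with angles \<open>2 * pi * x j\<close> in the coordinates in \<open>I\<close> and with the coordinates of \<open>z\<close>
  elsewhere. The set \<open>I\<close> of the coordinates that are integrated out grows in the
  induction below, while the type of the point is fixed.
\<close>
definition angle_point :: "'d set \<Rightarrow> complex^'d::finite \<Rightarrow> ('d \<Rightarrow> real) \<Rightarrow> complex^'d" where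
  "angle_point I z x = (\<chi> j. if j \<in> I then cis (2 * pi * x j) else z $ j)"

lemma angle_point_measurable:
  "angle_point I z \<in> borel_measurable (Pi\<^sub>M I (\<lambda>_. unit_interval_measure))"
proof -
  have "(\<lambda>x. angle_point I z x \<bullet> b) \<in> borel_measurable (Pi\<^sub>M I (\<lambda>_. unit_interval_measure))"
    if b: "b \<in> Basis" for b
  proof -
    from b obtain j c where b: "b = axis j c" by (auto simp: Basis_vec_def)
    show ?thesis
    proof (cases "j \<in> I")
      case True
      have [measurable]: "(\<lambda>x. x j) \<in> borel_measurable (Pi\<^sub>M I (\<lambda>_. unit_interval_measure))"
        using measurable_component_singleton[OF True, of "\<lambda>_. unit_interval_measure"]
        by (simp cong: measurable_cong_sets)
      have "(\<lambda>t. cis (2 * pi * t)) \<in> borel_measurable borel"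
        by (intro borel_measurable_continuous_onI continuous_intros continuous_on_compose2[OF continuous_on_cis]) auto
      then have "(\<lambda>x. cis (2 * pi * x j)) \<in> borel_measurable (Pi\<^sub>M I (\<lambda>_. unit_interval_measure))"
        by measurable
      then show ?thesis using True by (simp add: b inner_axis angle_point_def)
    qed (simp add: b inner_axis angle_point_def)
  qed
  then show ?thesis by (subst borel_measurable_euclidean_space) auto
qed

lemma angle_point_closed_polydisc:
  "z \<in> closed_polydisc \<Longrightarrow> angle_point I z x \<in> closed_polydisc"
  by (simp add: closed_polydisc_def angle_point_def)

lemma angle_point_insert:
  "angle_point (insert i I) z (x(i := y)) =
    (\<chi> j. if j = i then cis (2 * pi * y) else angle_point I z x $ j)"
  by (simp add: angle_point_def vec_eq_iff)

lemma compact_closed_polydisc: "compact (closed_polydisc :: (complex^'d::finite) set)"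
proof -
  have "closed (\<Inter>j. {z :: complex^'d. norm (z $ j) \<le> 1})"
    by (intro closed_INT ballI closed_Collect_le continuous_intros)
  moreover have "(\<Inter>j. {z :: complex^'d. norm (z $ j) \<le> 1}) = closed_polydisc"
    by (auto simp: closed_polydisc_def)
  moreover have "bounded (closed_polydisc :: (complex^'d) set)"
  proof (rule boundedI)
    fix z :: "complex^'d" assume "z \<in> closed_polydisc"
    then show "norm z \<le> (\<Sum>j\<in>(UNIV :: 'd set). 1)"
      unfolding norm_vec_def
      by (intro order_trans[OF L2_set_le_sum] sum_mono) (auto simp: closed_polydisc_def)
  qed
  ultimately show ?thesis by (simp add: compact_eq_bounded_closed)
qed

text \<open>
  Fubini's theorem and the formula for the circle, one coordinate at a time.
\<close>
lemma poisson_formula_angles: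
  assumes G: "G \<in> polydisc_algebra" and z: "z \<in> polydisc" and I: "finite I"
  shows "integral\<^sup>L (Pi\<^sub>M I (\<lambda>_. unit_interval_measure))
    (\<lambda>x. of_real (\<Prod>j\<in>I. circle_kernel (z $ j) (cis (2 * pi * x j))) * G (angle_point I z x)) = G z"
  using I
proof (induction I rule: finite_induct)
  case empty
  have "angle_point {} z x = z" for x by (simp add: angle_point_def vec_eq_iff)
  moreover have "prob_space (Pi\<^sub>M {} (\<lambda>_ :: 'a. unit_interval_measure))"
    by (rule prob_space_PiM) (rule prob_space_unit_interval_measure)
  ultimately show ?case by (simp add: prob_space.prob_space)
next
  case (insert i I)
  let ?P = "\<lambda>J. Pi\<^sub>M J (\<lambda>_. unit_interval_measure)"
  interpret U: prob_space unit_interval_measure by (rule prob_space_unit_interval_measure)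
  interpret product_prob_space "\<lambda>_. unit_interval_measure" by unfold_locales
  have zc: "z \<in> closed_polydisc" using z polydisc_subset by auto
  let ?f = "\<lambda>x. of_real (\<Prod>j\<in>insert i I. circle_kernel (z $ j) (cis (2 * pi * x j))) *
      G (angle_point (insert i I) z x)"
  have contG: "continuous_on closed_polydisc G" using G by (simp add: polydisc_algebra_def)
  have "integrable (?P (insert i I)) ?f"
  proof -
    interpret Q: prob_space "?P (insert i I)" by (rule prob_space_PiM) (rule prob_space_unit_interval_measure)
    define F where "F = (\<lambda>w. of_real (\<Prod>j\<in>insert i I. circle_kernel (z $ j) (w $ j)) * G w)"
    have contF: "continuous_on closed_polydisc F"
      unfolding F_def circle_kernel_def
      using z one_minus_cnj_mult_nonzero
      by (intro continuous_intros contG) (auto simp: polydisc_def closed_polydisc_def)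
    have f: "?f = (\<lambda>x. F (angle_point (insert i I) z x))"
      by (auto simp: F_def angle_point_def intro!: ext prod.cong)
    have "bounded (F ` closed_polydisc)"
      by (intro compact_imp_bounded compact_continuous_image contF compact_closed_polydisc)
    then obtain B where B: "\<And>w. w \<in> closed_polydisc \<Longrightarrow> norm (F w) \<le> B" by (auto simp: bounded_iff)
    have "angle_point (insert i I) z \<in> measurable (?P (insert i I)) (restrict_space borel closed_polydisc)"
      by (intro measurable_restrict_space2 angle_point_measurable)
        (auto intro: angle_point_closed_polydisc[OF zc])
    from measurable_compose[OF this borel_measurable_continuous_on_restrict[OF contF]]
    show ?thesis
      unfolding f
      by (intro Q.integrable_const_bound[of _ B]) (auto intro!: B angle_point_closed_polydisc zc)
  qed
  then have "integral\<^sup>L (?P (insert i I)) ?f = (\<integral>x. (\<integral>y. ?f (x(i := y)) \<partial>unit_interval_measure) \<partial>?P I)"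
    by (rule product_integral_insert[OF insert.hyps])
  also have "(\<lambda>x. (\<integral>y. ?f (x(i := y)) \<partial>unit_interval_measure)) =
      (\<lambda>x. of_real (\<Prod>j\<in>I. circle_kernel (z $ j) (cis (2 * pi * x j))) * G (angle_point I z x))"
  proof
    fix x
    let ?p = "angle_point I z x"
    let ?g = "\<lambda>t. G (\<chi> j. if j = i then t else ?p $ j)"
    have p: "?p \<in> closed_polydisc" by (rule angle_point_closed_polydisc[OF zc])
    have slice: "(\<chi> j. if j = i then t else ?p $ j) \<in> closed_polydisc" if "norm t \<le> 1" for t
      using p that by (auto simp: closed_polydisc_def)
    have prod: "(\<Prod>j\<in>I. circle_kernel (z $ j) (cis (2 * pi * (x(i := y)) j))) =
        (\<Prod>j\<in>I. circle_kernel (z $ j) (cis (2 * pi * x j)))" for y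
      using insert.hyps by (intro prod.cong) auto
    have "(\<integral>y. ?f (x(i := y)) \<partial>unit_interval_measure) =
      (\<integral>y. of_real (\<Prod>j\<in>I. circle_kernel (z $ j) (cis (2 * pi * x j))) *
         (of_real (circle_kernel (z $ i) (cis (2 * pi * y))) * ?g (cis (2 * pi * y))) \<partial>unit_interval_measure)"
      unfolding angle_point_insert prod.insert[OF insert.hyps] prod
      by (intro Bochner_Integration.integral_cong refl) simp
    also have "\<dots> = of_real (\<Prod>j\<in>I. circle_kernel (z $ j) (cis (2 * pi * x j))) * ?g (z $ i)"
    proof (subst integral_mult_right_zero, subst poisson_formula_circle)
      show "continuous_on (cball 0 1) ?g"
      proof (rule continuous_on_compose2[OF contG])
        have "continuous_on (cball 0 1) (\<lambda>t. if j = i then t else ?p $ j)" for j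
          by (cases "j = i") auto
        then show "continuous_on (cball 0 1) (\<lambda>t. \<chi> j. if j = i then t else ?p $ j)"
          by (intro continuous_on_vec_lambda)
      qed (auto intro!: slice)
      show "?g holomorphic_on ball 0 1" using G p by (simp add: polydisc_algebra_def)
      show "norm (z $ i) < 1" using z by (simp add: polydisc_def)
    qed simp
    also have "(\<chi> j. if j = i then z $ i else ?p $ j) = ?p"
      using insert.hyps by (simp add: vec_eq_iff angle_point_def)
    finally show "(\<integral>y. ?f (x(i := y)) \<partial>unit_interval_measure) =
      of_real (\<Prod>j\<in>I. circle_kernel (z $ j) (cis (2 * pi * x j))) * G ?p" .
  qed
  finally show ?case using insert.IH by simp
qed

definition torus_haar :: "(complex^'d::finite) measure" where
  "torus_haar = distr (Pi\<^sub>M UNIV (\<lambda>_. unit_interval_measure)) (restrict_space borel torus) (angle_point UNIV 0)"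

lemma angle_point_torus_measurable:
  "angle_point UNIV 0 \<in> measurable (Pi\<^sub>M UNIV (\<lambda>_. unit_interval_measure))
     (restrict_space borel (torus :: (complex^'d::finite) set))"
  by (intro measurable_restrict_space2 angle_point_measurable) (auto simp: angle_point_def torus_def)

lemma sets_torus_haar: "sets torus_haar = sets (restrict_space borel torus)"
  by (simp add: torus_haar_def)

lemma prob_space_torus_haar: "prob_space torus_haar"
  unfolding torus_haar_def
  by (intro prob_space.prob_space_distr prob_space_PiM prob_space_unit_interval_measure
      angle_point_torus_measurable)

text \<open>
  \<open>torus_haar\<close> is the rotation-invariant probability measure, and the Poisson kernel reproduces
  functions that are holomorphic inside and continuous up to the boundary.
\<close>
theorem poisson_formula_torus:
  fixes G :: "complex^'d::finite \<Rightarrow> complex"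
  assumes G: "G \<in> polydisc_algebra" and z: "z \<in> polydisc"
  shows "integral\<^sup>L torus_haar (\<lambda>w. of_real (poisson_kernel z w) * G w) = G z"
proof -
  have "continuous_on torus G"
    using G continuous_on_subset[OF _ torus_subset] by (auto simp: polydisc_algebra_def)
  then have "continuous_on torus (\<lambda>w. of_real (poisson_kernel z w) * G w)"
    by (intro continuous_intros continuous_poisson_kernel z)
  then have "integral\<^sup>L torus_haar (\<lambda>w. of_real (poisson_kernel z w) * G w) =
    integral\<^sup>L (Pi\<^sub>M UNIV (\<lambda>_. unit_interval_measure))
      (\<lambda>x. of_real (poisson_kernel z (angle_point UNIV 0 x)) * G (angle_point UNIV 0 x))"
    unfolding torus_haar_def
    by (intro integral_distr angle_point_torus_measurable borel_measurable_continuous_on_restrict)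
  also have "\<dots> = integral\<^sup>L (Pi\<^sub>M UNIV (\<lambda>_. unit_interval_measure))
    (\<lambda>x. of_real (\<Prod>j\<in>UNIV. circle_kernel (z $ j) (cis (2 * pi * x j))) * G (angle_point UNIV z x))"
  proof -
    have "angle_point UNIV 0 x = angle_point UNIV z x" "angle_point UNIV z x \<in> torus" for x
      by (simp_all add: angle_point_def torus_def)
    then show ?thesis
      by (simp add: poisson_kernel_eq_prod_circle_kernel) (simp add: angle_point_def)
  qed
  also have "\<dots> = G z" by (rule poisson_formula_angles[OF G z]) simp
  finally show ?thesis .
qed

corollary mean_value_torus:
  "G \<in> polydisc_algebra \<Longrightarrow> integral\<^sup>L torus_haar G = G 0"
  using poisson_formula_torus[OF _ zero_in_polydisc, of G] by (simp add: poisson_kernel_0)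

section \<open>The Schur algorithm and its polynomials\<close>

text \<open>
  The square of \<open>sinh (d / 2)\<close>, where \<open>d\<close> is the hyperbolic distance of \<open>a\<close> and \<open>b\<close>. Unlike the
  pseudohyperbolic distance, it is visibly contracted by the factor \<open>(norm c)\<^sup>2\<close> under
  multiplication by \<open>c\<close>.
\<close>
definition hyp_quot :: "complex \<Rightarrow> complex \<Rightarrow> real" where
  "hyp_quot a b = (norm (a - b))\<^sup>2 / ((1 - (norm a)\<^sup>2) * (1 - (norm b)\<^sup>2))"

lemma mobius_denominator_nonzero:
  assumes "norm r < 1" "norm a \<le> 1"
  shows "1 + cnj r * a \<noteq> 0"
  using one_minus_cnj_mult_nonzero[of r "- a"] assms by simp

lemma one_minus_norm_mobius:
  assumes "norm r < 1" "norm a \<le> 1"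
  shows "1 - (norm ((a + r) / (1 + cnj r * a)))\<^sup>2 =
    (1 - (norm r)\<^sup>2) * (1 - (norm a)\<^sup>2) / (norm (1 + cnj r * a))\<^sup>2"
proof -
  have "(norm (1 + cnj r * a))\<^sup>2 - (norm (a + r))\<^sup>2 = (1 - (norm r)\<^sup>2) * (1 - (norm a)\<^sup>2)"
    unfolding cmod_power2 by (simp add: power2_eq_square algebra_simps)
  then show ?thesis
    using mobius_denominator_nonzero[OF assms]
    by (simp add: norm_divide power_divide diff_divide_eq_iff)
qed

lemma norm_mobius_less_1:
  assumes "norm r < 1" "norm a < 1"
  shows "norm ((a + r) / (1 + cnj r * a)) < 1"
proof -
  have "0 < (1 - (norm r)\<^sup>2) * (1 - (norm a)\<^sup>2) / (norm (1 + cnj r * a))\<^sup>2"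
    using assms mobius_denominator_nonzero[of r a] by (simp add: abs_square_less_1)
  then have "(norm ((a + r) / (1 + cnj r * a)))\<^sup>2 < 1"
    using one_minus_norm_mobius[of r a] assms by simp
  then show ?thesis by (simp add: abs_square_less_1)
qed

lemma hyp_quot_mobius:
  assumes "norm r < 1" "norm a < 1" "norm b < 1"
  shows "hyp_quot ((a + r) / (1 + cnj r * a)) ((b + r) / (1 + cnj r * b)) = hyp_quot a b"
proof -
  have nz: "1 + cnj r * a \<noteq> 0" "1 + cnj r * b \<noteq> 0"
    using mobius_denominator_nonzero assms by auto
  have r: "1 - (norm r)\<^sup>2 > 0" using assms by (simp add: abs_square_less_1)
  have "(a + r) / (1 + cnj r * a) - (b + r) / (1 + cnj r * b) =
      (a - b) * (1 - r * cnj r) / ((1 + cnj r * a) * (1 + cnj r * b))"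
    using nz by (simp add: field_simps)
  also have "1 - r * cnj r = of_real (1 - (norm r)\<^sup>2)"
    by (simp only: of_real_diff of_real_1 complex_norm_square)
  finally have "norm ((a + r) / (1 + cnj r * a) - (b + r) / (1 + cnj r * b)) =
      norm (a - b) * (1 - (norm r)\<^sup>2) / (norm (1 + cnj r * a) * norm (1 + cnj r * b))"
    using r by (simp only: norm_divide norm_mult norm_of_real abs_of_pos)
  then show ?thesis
    unfolding hyp_quot_def using nz r assms
    by (simp add: one_minus_norm_mobius power_mult_distrib power_divide)
      (simp add: power2_eq_square divide_simps)
qed

lemma hyp_quot_mult_le:
  assumes "norm c \<le> \<rho>" "\<rho> \<le> 1" "norm a < 1" "norm b < 1"
  shows "hyp_quot (c * a) (c * b) \<le> \<rho>\<^sup>2 * hyp_quot a b"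
proof -
  have le: "1 - (norm x)\<^sup>2 \<le> 1 - (norm (c * x))\<^sup>2" for x
    using assms mult_left_le_one_le[of "norm x" "norm c"] by (simp add: norm_mult power_mono)
  have pos: "0 < 1 - (norm a)\<^sup>2" "0 < 1 - (norm b)\<^sup>2"
    using assms by (simp_all add: abs_square_less_1)
  have "hyp_quot (c * a) (c * b) = (norm c)\<^sup>2 * (norm (a - b))\<^sup>2 /
      ((1 - (norm (c * a))\<^sup>2) * (1 - (norm (c * b))\<^sup>2))"
    by (simp add: hyp_quot_def norm_mult power_mult_distrib flip: right_diff_distrib)
  also have "\<dots> \<le> \<rho>\<^sup>2 * (norm (a - b))\<^sup>2 / ((1 - (norm a)\<^sup>2) * (1 - (norm b)\<^sup>2))"
  proof (intro frac_le mult_mono power_mono mult_pos_pos mult_nonneg_nonneg le pos)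
    show "0 \<le> 1 - (norm (c * a))\<^sup>2" using pos(1) le[of a] by linarith
    show "0 \<le> 1 - (norm b)\<^sup>2" using pos(2) by linarith
  qed (use assms in auto)
  finally show ?thesis by (simp add: hyp_quot_def)
qed

text \<open>
  The denominator of \<open>hyp_quot\<close> is at most 1.
\<close>
lemma norm_diff_le_hyp_quot:
  assumes "norm a < 1" "norm b < 1"
  shows "(norm (a - b))\<^sup>2 \<le> hyp_quot a b"
proof -
  have pos: "0 < 1 - (norm a)\<^sup>2" "0 < 1 - (norm b)\<^sup>2"
    using assms by (simp_all add: abs_square_less_1)
  then have "(1 - (norm a)\<^sup>2) * (1 - (norm b)\<^sup>2) \<le> 1" by (intro mult_le_one) auto
  then show ?thesis
    using pos mult_left_mono[of _ 1 "(norm (a - b))\<^sup>2"]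
    by (simp add: hyp_quot_def pos_le_divide_eq)
qed

text \<open>
  \<open>k\<close> steps of the Schur algorithm in reverse, starting with the zero function at the level
  \<open>j + k\<close>. Zero instead of \<open>g_op (r (j + k)) 0\<close> as a start shifts the index of the convergents by one
  and makes all steps alike.
\<close>
primrec schur_tail ::
  "(nat \<Rightarrow> complex) \<Rightarrow> (nat \<Rightarrow> 'd::finite) \<Rightarrow> nat \<Rightarrow> nat \<Rightarrow> complex^'d \<Rightarrow> complex" where
  "schur_tail r \<nu> j 0 = (\<lambda>_. 0)"
| "schur_tail r \<nu> j (Suc k) = g_op (r j) (m_op (\<nu> (Suc j)) (schur_tail r \<nu> (Suc j) k))"

lemma convergent_fun_eq_schur_tail: "convergent_fun r \<nu> n = schur_tail r \<nu> 0 (Suc n)"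
proof -
  have "foldr (\<lambda>i h. g_op (r i) (m_op (\<nu> (Suc i)) h)) [j..<j + k] (g_op (r (j + k)) (\<lambda>_. 0)) =
      schur_tail r \<nu> j (Suc k)" for j k
  proof (induction k arbitrary: j)
    case 0
    then show ?case by (simp add: g_op_def m_op_def)
  next
    case (Suc k)
    then show ?case using Suc.IH[of "Suc j"] by (simp add: upt_conv_Cons del: upt_Suc)
  qed
  from this[of 0 n] show ?thesis by (simp add: convergent_fun_def)
qed

lemma schur_tail_bound:
  assumes r: "\<And>n. norm (r n) < 1" and z: "z \<in> closed_polydisc"
  shows "norm (schur_tail r \<nu> j k z) < 1"
proof (induction k arbitrary: j)
  case (Suc k)
  have "norm (z $ \<nu> (Suc j) * schur_tail r \<nu> (Suc j) k z) < 1"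
    using z Suc[of "Suc j"] mult_left_le_one_le[of "norm (schur_tail r \<nu> (Suc j) k z)" "norm (z $ \<nu> (Suc j))"]
    by (auto simp: norm_mult closed_polydisc_def intro: le_less_trans)
  then show ?case using norm_mobius_less_1[OF r] r by (simp add: g_op_def m_op_def)
qed simp

lemma schur_tail_polydisc_algebra:
  assumes r: "\<And>n. norm (r n) < 1"
  shows "schur_tail r \<nu> j k \<in> polydisc_algebra"
proof (induction k arbitrary: j)
  case (Suc k)
  let ?y = "\<lambda>z. z $ \<nu> (Suc j) * schur_tail r \<nu> (Suc j) k z"
  have nz: "1 + cnj (r j) * ?y z \<noteq> 0" if z: "z \<in> closed_polydisc" for z
  proof (rule mobius_denominator_nonzero[OF r])
    show "norm (?y z) \<le> 1"
      unfolding norm_mult using z schur_tail_bound[where r = r, OF r z, where \<nu> = \<nu> and j = "Suc j" and k = k]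
      by (intro mult_le_one) (auto simp: closed_polydisc_def)
  qed
  have "(\<lambda>z. (?y z + r j) / (1 + cnj (r j) * ?y z)) \<in> polydisc_algebra"
    by (intro polydisc_algebra_divide polydisc_algebra_add polydisc_algebra_mult
        polydisc_algebra_const polydisc_algebra_coordinate Suc nz)
  then show ?case using r by (simp add: g_op_def m_op_def)
qed (simp add: polydisc_algebra_const)

text \<open>
  Each step of the Schur algorithm is an isometry of the hyperbolic disc after a multiplication by a
  coordinate of \<open>z\<close>, whose norm is at most some \<open>\<rho> < 1\<close>. So \<open>k\<close> steps contract by \<open>\<rho> ^ (2 * k)\<close>, and
  the innermost one starts from a bound that does not depend on the level.
\<close>
lemma schur_tail_tendsto:
  assumes r: "\<And>n. norm (r n) < 1"
    and z: "z \<in> polydisc"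
    and h: "\<And>n. norm (h n z) \<le> 1"
    and step: "\<And>n. h n z = g_op (r n) (m_op (\<nu> (Suc n)) (h (Suc n))) z"
  shows "(\<lambda>k. schur_tail r \<nu> 0 k z) \<longlonglongrightarrow> h 0 z"
proof -
  define \<rho> where "\<rho> = Max (range (\<lambda>j. norm (z $ j)))"
  have le: "norm (z $ j) \<le> \<rho>" for j unfolding \<rho>_def by (rule Max_ge) auto
  have \<rho>: "0 \<le> \<rho>" "\<rho> < 1"
    using order_trans[OF norm_ge_zero le[of undefined]] z by (auto simp: \<rho>_def polydisc_def)
  have y: "norm (z $ \<nu> (Suc n) * h (Suc n) z) \<le> \<rho>" for n
    using mult_mono[OF le[of "\<nu> (Suc n)"] h[of "Suc n"]] \<rho> by (simp add: norm_mult)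
  have h1: "norm (h n z) < 1" for n
    using norm_mobius_less_1[OF r, of "z $ \<nu> (Suc n) * h (Suc n) z" n] y[of n] \<rho> r[of n]
    by (subst step) (simp add: g_op_def m_op_def)
  have t1: "norm (schur_tail r \<nu> j k z) < 1" for j k
    using schur_tail_bound[where r = r, OF r] z polydisc_subset by blast
  define B where "B = 1 / (1 - \<rho>\<^sup>2)"
  have contract: "hyp_quot (h j z) (schur_tail r \<nu> j (Suc k) z) \<le>
      \<rho>\<^sup>2 * hyp_quot (h (Suc j) z) (schur_tail r \<nu> (Suc j) k z)" for j k
  proof -
    have "norm (z $ \<nu> (Suc j) * schur_tail r \<nu> (Suc j) k z) < 1"
      using mult_mono[OF le[of "\<nu> (Suc j)"], of "norm (schur_tail r \<nu> (Suc j) k z)" 1] t1[of "Suc j" k] \<rho>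
      by (simp add: norm_mult)
    then have "hyp_quot (h j z) (schur_tail r \<nu> j (Suc k) z) =
        hyp_quot (z $ \<nu> (Suc j) * h (Suc j) z) (z $ \<nu> (Suc j) * schur_tail r \<nu> (Suc j) k z)"
      using hyp_quot_mobius[OF r] y[of j] \<rho> r[of j]
      by (subst step) (simp add: g_op_def m_op_def)
    also have "\<dots> \<le> \<rho>\<^sup>2 * hyp_quot (h (Suc j) z) (schur_tail r \<nu> (Suc j) k z)"
      by (rule hyp_quot_mult_le[OF le _ h1 t1]) (use \<rho> in simp)
    finally show ?thesis .
  qed
  have "hyp_quot (h j z) (schur_tail r \<nu> j (Suc k) z) \<le> (\<rho>\<^sup>2) ^ k * B" for j k
  proof (induction k arbitrary: j)
    case 0
    have "\<rho>\<^sup>2 < 1" using \<rho> by (simp add: abs_square_less_1)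
    have yj: "(norm (z $ \<nu> (Suc j) * h (Suc j) z))\<^sup>2 \<le> \<rho>\<^sup>2"
      using y[of j] by (intro power_mono) auto
    have "hyp_quot (h j z) (schur_tail r \<nu> j (Suc 0) z) = hyp_quot (z $ \<nu> (Suc j) * h (Suc j) z) 0"
      using hyp_quot_mobius[OF r, of "z $ \<nu> (Suc j) * h (Suc j) z" 0 j] y[of j] \<rho> r[of j]
      by (subst step) (simp add: g_op_def m_op_def)
    also have "\<dots> \<le> B"
      unfolding hyp_quot_def B_def using yj \<open>\<rho>\<^sup>2 < 1\<close>
      by simp (intro frac_le; simp)
    finally show ?case by simp
  next
    case (Suc k)
    have "hyp_quot (h j z) (schur_tail r \<nu> j (Suc (Suc k)) z) \<le>
        \<rho>\<^sup>2 * hyp_quot (h (Suc j) z) (schur_tail r \<nu> (Suc j) (Suc k) z)"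
      by (rule contract)
    also have "\<dots> \<le> \<rho>\<^sup>2 * ((\<rho>\<^sup>2) ^ k * B)"
      using Suc by (intro mult_left_mono) auto
    finally show ?case by (simp add: mult.assoc)
  qed
  then have bound: "(norm (h 0 z - schur_tail r \<nu> 0 (Suc k) z))\<^sup>2 \<le> (\<rho>\<^sup>2) ^ k * B" for k
    using norm_diff_le_hyp_quot[OF h1 t1] order_trans by blast
  have "(\<lambda>k. (\<rho>\<^sup>2) ^ k * B) \<longlonglongrightarrow> 0 * B"
    using \<rho> by (intro tendsto_mult LIMSEQ_realpow_zero tendsto_const) (auto simp: abs_square_less_1)
  then have lim0: "(\<lambda>k. (\<rho>\<^sup>2) ^ k * B) \<longlonglongrightarrow> 0" by simp
  have "(\<lambda>k. (norm (h 0 z - schur_tail r \<nu> 0 (Suc k) z))\<^sup>2) \<longlonglongrightarrow> 0"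
    by (rule tendsto_sandwich[OF _ _ tendsto_const lim0]) (intro always_eventually allI zero_le_power2 bound)+
  from tendsto_real_sqrt[OF this]
  have "(\<lambda>k. norm (h 0 z - schur_tail r \<nu> 0 (Suc k) z)) \<longlonglongrightarrow> 0"
    by (simp only: real_sqrt_abs abs_norm_cancel real_sqrt_zero)
  from tendsto_diff[OF tendsto_const[of "h 0 z"] tendsto_norm_zero_cancel[OF this]]
  have "(\<lambda>k. schur_tail r \<nu> 0 (Suc k) z) \<longlonglongrightarrow> h 0 z"
    by (simp only: diff_diff_eq2 add_diff_cancel_left' diff_zero)
  then show ?thesis by (rule LIMSEQ_imp_Suc)
qed

lemma Phi_0 [simp]: "Phi r \<nu> 0 z = 1" and Phi_star_0 [simp]: "Phi_star r \<nu> 0 z = 1"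
  by (simp_all add: Phi_def Phi_star_def M_zero_def)

lemma Phi_Suc [simp]:
  "Phi r \<nu> (Suc n) z = z $ \<nu> (Suc n) * Phi r \<nu> n z - cnj (r (Suc n)) * Phi_star r \<nu> n z"
  by (simp add: Phi_def Phi_star_def M_step_def matrix_matrix_mult_def sum_2 algebra_simps)

lemma Phi_star_Suc [simp]:
  "Phi_star r \<nu> (Suc n) z = Phi_star r \<nu> n z - r (Suc n) * z $ \<nu> (Suc n) * Phi r \<nu> n z"
  by (simp add: Phi_def Phi_star_def M_step_def matrix_matrix_mult_def sum_2 algebra_simps)

lemma Phi_polydisc_algebra:
  "Phi r \<nu> n \<in> polydisc_algebra \<and> Phi_star r \<nu> n \<in> polydisc_algebra"
proof (induction n)
  case 0
  have "Phi r \<nu> 0 = (\<lambda>_. 1)" "Phi_star r \<nu> 0 = (\<lambda>_. 1)" by auto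
  then show ?case by (simp add: polydisc_algebra_const)
next
  case (Suc n)
  have "Phi r \<nu> (Suc n) = (\<lambda>z. z $ \<nu> (Suc n) * Phi r \<nu> n z - cnj (r (Suc n)) * Phi_star r \<nu> n z)"
    "Phi_star r \<nu> (Suc n) = (\<lambda>z. Phi_star r \<nu> n z - r (Suc n) * z $ \<nu> (Suc n) * Phi r \<nu> n z)"
    by auto
  then show ?case
    using Suc by (auto intro!: polydisc_algebra_intros)
qed

text \<open>
  With \<open>b = z $ \<nu> (n + 1) * Phi n / Phi_star n\<close>, a point of the closed unit disc by induction, one step of the recursion
  multiplies \<open>Phi_star\<close> by \<open>1 - r * b\<close>, which does not vanish, and replaces the quotient by
  \<open>(b - cnj r) / (1 - r * b)\<close>, again a point of the closed disc.
\<close>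
lemma Phi_star_nonzero:
  assumes r: "\<And>n. norm (r n) < 1" and z: "z \<in> closed_polydisc"
  shows "Phi_star r \<nu> n z \<noteq> 0 \<and> norm (Phi r \<nu> n z) \<le> norm (Phi_star r \<nu> n z)"
proof (induction n)
  case (Suc n)
  define b where "b = z $ \<nu> (Suc n) * Phi r \<nu> n z / Phi_star r \<nu> n z"
  let ?\<rho> = "r (Suc n)"
  have S: "Phi_star r \<nu> n z \<noteq> 0" using Suc by simp
  have b: "norm b \<le> 1"
    using Suc z mult_mono[of "norm (z $ \<nu> (Suc n))" 1 "norm (Phi r \<nu> n z)" "norm (Phi_star r \<nu> n z)"]
    by (simp add: b_def norm_divide norm_mult closed_polydisc_def)
  have star: "Phi_star r \<nu> (Suc n) z = Phi_star r \<nu> n z * (1 - ?\<rho> * b)"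
    and Phi: "Phi r \<nu> (Suc n) z = Phi_star r \<nu> n z * (b - cnj ?\<rho>)"
    using S by (simp_all add: b_def field_simps)
  have nz: "1 - ?\<rho> * b \<noteq> 0"
    using one_minus_cnj_mult_nonzero[of "cnj ?\<rho>" b] b r by simp
  have "(norm (b - cnj ?\<rho>))\<^sup>2 \<le> (norm (1 - ?\<rho> * b))\<^sup>2"
  proof -
    have "(norm (1 - ?\<rho> * b))\<^sup>2 - (norm (b - cnj ?\<rho>))\<^sup>2 = (1 - (norm ?\<rho>)\<^sup>2) * (1 - (norm b)\<^sup>2)"
      unfolding cmod_power2 by (simp add: power2_eq_square algebra_simps)
    moreover have "\<dots> \<ge> 0"
      using r[of "Suc n"] b by (intro mult_nonneg_nonneg) (auto simp: abs_square_le_1)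
    ultimately show ?thesis by linarith
  qed
  then have "norm (b - cnj ?\<rho>) \<le> norm (1 - ?\<rho> * b)" by (rule power2_le_imp_le) simp
  then show ?case
    unfolding star Phi using S nz by (simp add: norm_mult mult_left_mono)
qed simp

lemma Phi_star_at_0: "Phi_star r \<nu> n 0 = 1"
  by (induction n) simp_all

text \<open>
  On the torus, \<open>Phi_star\<close> is the reversed polynomial of \<open>Phi\<close>, as for orthogonal polynomials on the
  circle; the power of the variable is replaced by the product of the allocated variables.
\<close>
lemma Phi_star_reversed:
  assumes w: "w \<in> torus"
  shows "Phi_star r \<nu> n w = (\<Prod>i=1..n. w $ \<nu> i) * cnj (Phi r \<nu> n w) \<and>
    Phi r \<nu> n w = (\<Prod>i=1..n. w $ \<nu> i) * cnj (Phi_star r \<nu> n w)"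
proof (induction n)
  case (Suc n)
  let ?Z = "\<Prod>i=1..n. w $ \<nu> i" and ?x = "w $ \<nu> (Suc n)"
  have x: "?x * cnj ?x = 1"
    using w complex_norm_square[of ?x] by (simp add: torus_def)
  have "?Z * ?x * cnj (Phi r \<nu> (Suc n) w) =
      (?x * cnj ?x) * (?Z * cnj (Phi r \<nu> n w)) - r (Suc n) * ?x * (?Z * cnj (Phi_star r \<nu> n w))"
    by (simp add: algebra_simps)
  moreover have "?Z * ?x * cnj (Phi_star r \<nu> (Suc n) w) =
      ?x * (?Z * cnj (Phi_star r \<nu> n w)) - cnj (r (Suc n)) * ((?x * cnj ?x) * (?Z * cnj (Phi r \<nu> n w)))"
    by (simp add: algebra_simps)
  ultimately show ?case
    unfolding x using Suc[THEN conjunct1, symmetric] Suc[THEN conjunct2, symmetric]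
    by (simp del: complex_cnj_mult complex_cnj_diff add: )
qed simp

lemma Re_cayley: "Re ((1 + a) / (1 - a)) = (1 - (norm a)\<^sup>2) / (norm (1 - a))\<^sup>2"
proof -
  have "Re ((1 + a) / (1 - a)) = Re ((1 + a) * cnj (1 - a)) / (norm (1 - a))\<^sup>2"
    by (simp add: Re_divide cmod_power2)
  also have "Re ((1 + a) * cnj (1 - a)) = 1 - (norm a)\<^sup>2"
    unfolding cmod_power2 by (simp add: power2_eq_square algebra_simps)
  finally show ?thesis .
qed

text \<open>
  How the density of the measure of \<open>a 0\<close> depends on the remainder \<open>y n\<close> after \<open>n\<close> steps. One step is the
  substitution \<open>y n = w $ \<nu> (n + 1) * (y + r) / (1 + cnj r * y)\<close>, which multiplies
  \<open>1 - (norm y)\<^sup>2\<close> by the factor \<open>1 - (norm r)\<^sup>2\<close> and turns the linear form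
  \<open>Phi_star - y * Phi\<close> into that of the next level; the common denominator \<open>1 + cnj r * y\<close>
  cancels. For \<open>y n = 0\<close> this is the Bernstein--Szego formula.
\<close>
lemma density_transfer:
  fixes y a :: "nat \<Rightarrow> complex"
  assumes r: "r 0 = 0" "\<And>n. norm (r n) < 1" and w: "w \<in> torus"
    and a: "\<And>i. i \<le> n \<Longrightarrow> a i = (y i + r i) / (1 + cnj (r i) * y i)"
    and y: "\<And>i. i < n \<Longrightarrow> y i = w $ \<nu> (Suc i) * a (Suc i)"
    and y1: "\<And>i. i \<le> n \<Longrightarrow> norm (y i) < 1"
  shows "(1 - (norm (a 0))\<^sup>2) / (norm (1 - a 0))\<^sup>2 =
    (\<Prod>s=1..n. 1 - (norm (r s))\<^sup>2) * (1 - (norm (y n))\<^sup>2) /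
      (norm (Phi_star r \<nu> n w - y n * Phi r \<nu> n w))\<^sup>2"
  using a y y1
proof (induction n)
  case 0
  then show ?case using r by simp
next
  case (Suc n)
  let ?\<rho> = "r (Suc n)" and ?y = "y (Suc n)" and ?x = "w $ \<nu> (Suc n)"
  have IH: "(1 - (norm (a 0))\<^sup>2) / (norm (1 - a 0))\<^sup>2 =
    (\<Prod>s=1..n. 1 - (norm (r s))\<^sup>2) * (1 - (norm (y n))\<^sup>2) /
      (norm (Phi_star r \<nu> n w - y n * Phi r \<nu> n w))\<^sup>2"
    by (rule Suc.IH; rule Suc.prems; simp)
  have ya: "y n = ?x * ((?y + ?\<rho>) / (1 + cnj ?\<rho> * ?y))"
    using Suc.prems(1)[of "Suc n"] Suc.prems(2)[of n] by simp
  have nz: "1 + cnj ?\<rho> * ?y \<noteq> 0"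
    using mobius_denominator_nonzero[OF r(2)] Suc.prems(3)[of "Suc n"] by (simp add: less_imp_le)
  have x: "norm ?x = 1" using w by (simp add: torus_def)
  have num: "1 - (norm (y n))\<^sup>2 =
      (1 - (norm ?\<rho>)\<^sup>2) * (1 - (norm ?y)\<^sup>2) / (norm (1 + cnj ?\<rho> * ?y))\<^sup>2"
    unfolding ya norm_mult[of ?x] x
    using one_minus_norm_mobius[OF r(2)[of "Suc n"], of ?y] Suc.prems(3)[of "Suc n"] by simp
  have "Phi_star r \<nu> n w - y n * Phi r \<nu> n w =
      (Phi_star r \<nu> (Suc n) w - ?y * Phi r \<nu> (Suc n) w) / (1 + cnj ?\<rho> * ?y)"
    using nz by (simp add: ya field_simps)
  then show ?case
    unfolding IH num using nz by (simp add: norm_divide power_divide)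
qed

section \<open>Measures of the convergents, orthogonality, and the limit\<close>

lemma continuous_on_torus_polydisc_algebra:
  "G \<in> polydisc_algebra \<Longrightarrow> continuous_on torus G"
  using continuous_on_subset[OF _ torus_subset] by (auto simp: polydisc_algebra_def)

lemma finite_measure_torus_haar: "finite_measure torus_haar"
  using prob_space_torus_haar by (auto simp: prob_space_def)

lemmas continuous_haar_integrable =
  continuous_torus_integrable[OF finite_measure_torus_haar sets_torus_haar]

text \<open>
  If \<open>h\<close> stays below 1 in norm up to the boundary, then its Caratheodory function is in the polydisc algebra, and the
  Poisson formula says that its real part is the density of the representing measure.
\<close>
lemma cayley_density:
  fixes h :: "complex^'d::finite \<Rightarrow> complex"
  assumes h: "h \<in> polydisc_algebra" and h1: "\<And>z. z \<in> closed_polydisc \<Longrightarrow> norm (h z) < 1"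
  defines "M \<equiv> density torus_haar (\<lambda>w. ennreal (Re ((1 + h w) / (1 - h w))))"
  shows cayley_density_represents: "represents_on_torus M h"
    and integral_cayley_density: "\<And>u :: complex^'d \<Rightarrow> complex. continuous_on torus u \<Longrightarrow>
      integral\<^sup>L M u = integral\<^sup>L torus_haar (\<lambda>w. of_real (Re ((1 + h w) / (1 - h w))) * u w)"
proof -
  define F where "F z = (1 + h z) / (1 - h z)" for z
  have "1 - h z \<noteq> 0" if "z \<in> closed_polydisc" for z using h1[OF that] by auto
  then have F: "F \<in> polydisc_algebra"
    unfolding F_def[abs_def]
    by (intro polydisc_algebra_divide polydisc_algebra_add polydisc_algebra_diff polydisc_algebra_const h)
  have contF: "continuous_on torus F" by (rule continuous_on_torus_polydisc_algebra[OF F])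
  have cont: "continuous_on torus (\<lambda>w. Re (F w))" by (intro continuous_intros contF)
  have meas: "(\<lambda>w. Re (F w)) \<in> borel_measurable torus_haar"
    by (rule continuous_torus_measurable[OF sets_torus_haar cont])
  have nonneg: "AE w in torus_haar. 0 \<le> Re (F w)"
  proof (rule AE_I2)
    fix w :: "complex^'d" assume "w \<in> space torus_haar"
    then have "norm (h w) < 1"
      using h1[of w] torus_subset space_torus_measure[OF sets_torus_haar] by auto
    then show "0 \<le> Re (F w)"
      unfolding F_def Re_cayley by (simp add: abs_square_le_1 less_imp_le)
  qed
  have M: "M = density torus_haar (\<lambda>w. ennreal (Re (F w)))" by (simp add: M_def F_def)
  have setsM: "sets M = sets (restrict_space borel torus)" by (simp add: M sets_torus_haar)
  show "integral\<^sup>L M u = integral\<^sup>L torus_haar (\<lambda>w. of_real (Re ((1 + h w) / (1 - h w))) * u w)"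
    if u: "continuous_on torus u" for u :: "complex^'d \<Rightarrow> complex"
  proof -
    have "u \<in> borel_measurable torus_haar" by (rule continuous_torus_measurable[OF sets_torus_haar u])
    from integral_density[OF this meas nonneg] show ?thesis
      by (simp add: M F_def scaleR_conv_of_real)
  qed
  have "has_bochner_integral M (poisson_kernel z) (Re (F z))" if z: "z \<in> polydisc" for z
  proof -
    have contK: "continuous_on torus (poisson_kernel z)" by (rule continuous_poisson_kernel[OF z])
    have measK: "poisson_kernel z \<in> borel_measurable torus_haar"
      by (rule continuous_torus_measurable[OF sets_torus_haar contK])
    have "integrable torus_haar (\<lambda>w. Re (F w) *\<^sub>R poisson_kernel z w)"
      by (intro continuous_haar_integrable continuous_intros contK contF)
    then have "integrable M (poisson_kernel z)"
      unfolding M using integrable_density[OF measK meas nonneg] by simp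
    moreover have "integral\<^sup>L M (poisson_kernel z) = Re (F z)"
    proof -
      have "integral\<^sup>L M (poisson_kernel z) = integral\<^sup>L torus_haar (\<lambda>w. Re (F w) *\<^sub>R poisson_kernel z w)"
        unfolding M by (rule integral_density[OF measK meas nonneg])
      also have "\<dots> = integral\<^sup>L torus_haar (\<lambda>w. Re (of_real (poisson_kernel z w) * F w))"
        by (simp add: mult.commute)
      also have "\<dots> = Re (integral\<^sup>L torus_haar (\<lambda>w. of_real (poisson_kernel z w) * F w))"
        by (intro integral_Re continuous_haar_integrable continuous_intros contK contF)
      also have "\<dots> = Re (F z)" by (simp only: poisson_formula_torus[OF F z])
      finally show ?thesis .
    qed
    ultimately show ?thesis by (simp add: has_bochner_integral_iff)
  qed
  then show "represents_on_torus M h"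
    using setsM by (simp add: represents_on_torus_def F_def)
qed

lemma represents_on_torus_prob:
  assumes M: "represents_on_torus M h" and "h 0 = 0"
  shows "prob_space M"
proof -
  interpret finite_measure M by (rule represents_on_torus_finite[OF M])
  have "integral\<^sup>L M (poisson_kernel 0) = 1"
    using M zero_in_polydisc \<open>h 0 = 0\<close> by (auto simp: represents_on_torus_def has_bochner_integral_iff)
  then have "measure M (space M) = 1" by (simp add: poisson_kernel_0[abs_def])
  then show ?thesis by (intro prob_spaceI) (simp add: emeasure_eq_measure)
qed

text \<open>
  Put \<open>b = Phi j / Phi_star j\<close>, which is unimodular on the torus, and \<open>G = y * b / (1 - y * b)\<close>. The density is
  \<open>1 + G + cnj G\<close> divided by \<open>(norm (Phi_star j))\<^sup>2\<close>. By the reversal formula, the product of the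
  two polynomials divided by \<open>(norm (Phi_star j))\<^sup>2\<close> is the function \<open>Q\<close>, which is in the polydisc algebra. Moreover
  \<open>Q * cnj G\<close> is the conjugate of such a function \<open>R\<close>, because \<open>b * cnj b = 1\<close>. So the mean value property
  evaluates the integral at the origin, where \<open>G\<close> and \<open>R\<close> vanish together with \<open>y\<close>, and \<open>Q\<close>
  vanishes unless its monomial \<open>V\<close> is empty.
\<close>
lemma integral_Phi_against_density:
  fixes y :: "complex^'d::finite \<Rightarrow> complex" and \<nu> :: "nat \<Rightarrow> 'd"
  assumes r: "\<And>n. norm (r n) < 1" and "k \<le> j"
    and y: "y \<in> polydisc_algebra" and y1: "\<And>z. z \<in> closed_polydisc \<Longrightarrow> norm (y z) < 1" and y0: "y 0 = 0"
  shows "integral\<^sup>L torus_haar (\<lambda>w. of_real ((1 - (norm (y w))\<^sup>2) /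
      (norm (Phi_star r \<nu> j w - y w * Phi r \<nu> j w))\<^sup>2) * (Phi r \<nu> j w * cnj (Phi r \<nu> k w))) =
    (if j = k then 1 else 0)"
proof -
  note P = conjunct1[OF Phi_polydisc_algebra] and S = conjunct2[OF Phi_polydisc_algebra]
  have S0: "Phi_star r \<nu> j z \<noteq> 0" and PS: "norm (Phi r \<nu> j z) \<le> norm (Phi_star r \<nu> j z)"
    if "z \<in> closed_polydisc" for z
    using Phi_star_nonzero[where r = r, OF r that] by auto
  define b where "b = (\<lambda>z. Phi r \<nu> j z / Phi_star r \<nu> j z)"
  have b: "b \<in> polydisc_algebra" unfolding b_def by (intro polydisc_algebra_divide P S S0)
  have yb1: "norm (y z * b z) < 1" if "z \<in> closed_polydisc" for z
  proof -
    have "norm (b z) \<le> 1" using S0[OF that] PS[OF that] by (simp add: b_def norm_divide)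
    then have "norm (y z * b z) \<le> norm (y z)" by (simp add: norm_mult mult_left_le)
    then show ?thesis using y1[OF that] by simp
  qed
  have yb: "1 - y z * b z \<noteq> 0" if "z \<in> closed_polydisc" for z
    using yb1[OF that] by auto
  define G where "G = (\<lambda>z. y z * b z / (1 - y z * b z))"
  define V where "V = (\<lambda>z :: complex^'d. \<Prod>i\<in>{Suc k..j}. z $ \<nu> i)"
  define Q where "Q = (\<lambda>z. V z * Phi_star r \<nu> k z / Phi_star r \<nu> j z)"
  define R where "R = (\<lambda>z. y z / (1 - y z * b z) * (Phi r \<nu> k z / Phi_star r \<nu> j z))"
  have V: "V \<in> polydisc_algebra"
    unfolding V_def by (intro polydisc_algebra_prod polydisc_algebra_coordinate) auto
  have Q: "Q \<in> polydisc_algebra"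
    unfolding Q_def by (intro polydisc_algebra_divide polydisc_algebra_mult V S S0)
  have QG: "(\<lambda>z. Q z * (1 + G z)) \<in> polydisc_algebra"
    unfolding G_def
    by (intro polydisc_algebra_divide polydisc_algebra_mult polydisc_algebra_add polydisc_algebra_diff
        polydisc_algebra_const Q y b yb)
  have R: "R \<in> polydisc_algebra"
    unfolding R_def
    by (intro polydisc_algebra_divide polydisc_algebra_mult polydisc_algebra_diff
        polydisc_algebra_const P S S0 y b yb)
  have pointwise: "of_real ((1 - (norm (y w))\<^sup>2) / (norm (Phi_star r \<nu> j w - y w * Phi r \<nu> j w))\<^sup>2) *
      (Phi r \<nu> j w * cnj (Phi r \<nu> k w)) = Q w * (1 + G w) + cnj (R w)" if w: "w \<in> torus" for w
  proof -
    have wc: "w \<in> closed_polydisc" using w torus_subset by auto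
    let ?D = "Phi_star r \<nu> j w" and ?P = "Phi r \<nu> j w" and ?Pk = "Phi r \<nu> k w"
    let ?t = "y w * b w"
    have D0: "?D \<noteq> 0" by (rule S0[OF wc])
    have t: "1 - ?t \<noteq> 0" by (rule yb[OF wc])
    then have t': "1 - cnj ?t \<noteq> 0"
      by (metis complex_cnj_cancel_iff complex_cnj_diff complex_cnj_one complex_cnj_zero)
    have Pb: "?P = ?D * b w" using D0 by (simp add: b_def)
    have norm_Z: "norm (\<Prod>i=1..j. w $ \<nu> i) = 1"
      using w by (simp add: torus_def flip: prod_norm)
    have "norm ?P = norm ?D"
      using Phi_star_reversed[OF w, of r \<nu> j] norm_Z by (metis complex_mod_cnj mult_1 norm_mult)
    then have nb: "norm (b w) = 1" using D0 by (simp add: b_def norm_divide)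
    then have bb: "b w * cnj (b w) = 1" using complex_norm_square[of "b w"] by simp
    have Qw: "Q w = b w * cnj ?Pk / cnj ?D"
    proof -
      have Z: "(\<Prod>i=1..j. w $ \<nu> i) = (\<Prod>i=1..k. w $ \<nu> i) * V w"
        unfolding V_def using \<open>k \<le> j\<close> prod.ub_add_nat[of 1 k "\<lambda>i. w $ \<nu> i" "j - k"] by simp
      have "V w * Phi_star r \<nu> k w * cnj ?D = ((\<Prod>i=1..j. w $ \<nu> i) * cnj ?D) * cnj ?Pk"
        unfolding Z by (subst conjunct1[OF Phi_star_reversed[OF w, of r \<nu> k]]) (simp only: mult_ac)
      also have "(\<Prod>i=1..j. w $ \<nu> i) * cnj ?D = ?P"
        by (rule conjunct2[OF Phi_star_reversed[OF w], symmetric])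
      finally have "V w * Phi_star r \<nu> k w * cnj ?D = ?D * (b w * cnj ?Pk)"
        by (simp add: Pb)
      then show ?thesis using D0 by (simp add: Q_def frac_eq_eq mult_ac)
    qed
    have cR: "cnj (R w) = Q w * cnj (G w)"
    proof -
      have "Q w * cnj (G w) = (b w * cnj (b w)) * (cnj (y w) * cnj ?Pk / (cnj ?D * cnj (1 - ?t)))"
        by (simp add: Qw G_def)
      then show ?thesis unfolding bb by (simp add: R_def)
    qed
    have partial_fractions: "(1 - t * s) / ((1 - t) * (1 - s)) = 1 + t / (1 - t) + s / (1 - s)"
      if "1 - t \<noteq> 0" "1 - s \<noteq> 0" for t s :: complex
    proof -
      have "1 - t * s = (1 - t) * (1 - s) + t * (1 - s) + s * (1 - t)" by (simp add: algebra_simps)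
      then show ?thesis using that by (simp add: add_divide_distrib)
    qed
    have ny: "(norm (y w))\<^sup>2 = (norm ?t)\<^sup>2" using nb by (simp add: norm_mult)
    have "complex_of_real ((1 - (norm (y w))\<^sup>2) / (norm (?D - y w * ?P))\<^sup>2) =
        (1 - ?t * cnj ?t) / (?D * (1 - ?t) * cnj (?D * (1 - ?t)))"
    proof -
      have D: "?D - y w * ?P = ?D * (1 - ?t)" by (simp add: Pb algebra_simps)
      show ?thesis unfolding ny D
        by (simp only: of_real_divide of_real_diff of_real_1 complex_norm_square)
    qed
    also have "\<dots> = (1 - ?t * cnj ?t) / ((1 - ?t) * (1 - cnj ?t)) / (?D * cnj ?D)"
      by (simp add: mult_ac)
    also have "\<dots> = (1 + G w + cnj (G w)) / (?D * cnj ?D)"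
      unfolding partial_fractions[OF t t'] by (simp add: G_def)
    finally have "of_real ((1 - (norm (y w))\<^sup>2) / (norm (?D - y w * ?P))\<^sup>2) * (?P * cnj ?Pk) =
        (1 + G w + cnj (G w)) * Q w"
      using D0 by (simp add: Qw Pb)
    then show ?thesis by (simp add: cR algebra_simps)
  qed
  have "integral\<^sup>L torus_haar (\<lambda>w. of_real ((1 - (norm (y w))\<^sup>2) /
      (norm (Phi_star r \<nu> j w - y w * Phi r \<nu> j w))\<^sup>2) * (Phi r \<nu> j w * cnj (Phi r \<nu> k w))) =
    integral\<^sup>L torus_haar (\<lambda>w. Q w * (1 + G w) + cnj (R w))"
    by (intro Bochner_Integration.integral_cong refl pointwise)
      (simp add: space_torus_measure[OF sets_torus_haar])
  also have "\<dots> = integral\<^sup>L torus_haar (\<lambda>w. Q w * (1 + G w)) + cnj (integral\<^sup>L torus_haar R)"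
    by (subst Bochner_Integration.integral_add)
      (auto intro!: continuous_haar_integrable continuous_on_torus_polydisc_algebra QG R continuous_intros)
  also have "\<dots> = Q 0 * (1 + G 0) + cnj (R 0)"
    by (simp only: mean_value_torus[OF QG] mean_value_torus[OF R])
  also have "\<dots> = V 0" by (simp add: G_def R_def y0 Q_def Phi_star_at_0)
  also have "\<dots> = (if j = k then 1 else 0)"
    using \<open>k \<le> j\<close> by (auto simp: V_def)
  finally show ?thesis .
qed

context
  fixes r :: "nat \<Rightarrow> complex" and \<nu> :: "nat \<Rightarrow> 'd::finite"
  assumes r0: "r 0 = 0" and r1: "\<And>n. norm (r n) < 1"
begin

lemma convergent_fun_polydisc_algebra: "convergent_fun r \<nu> n \<in> polydisc_algebra"
  unfolding convergent_fun_eq_schur_tail by (rule schur_tail_polydisc_algebra[where r = r, OF r1])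

lemma convergent_fun_bound: "z \<in> closed_polydisc \<Longrightarrow> norm (convergent_fun r \<nu> n z) < 1"
  unfolding convergent_fun_eq_schur_tail by (rule schur_tail_bound[where r = r, OF r1])

lemma convergent_fun_at_0: "convergent_fun r \<nu> n 0 = 0"
  by (simp add: convergent_fun_eq_schur_tail g_op_def m_op_def r0)

lemma mu_convergent_fun:
  shows mu_convergent_fun_represents: "represents_on_torus (mu (convergent_fun r \<nu> n)) (convergent_fun r \<nu> n)"
    and integral_mu_convergent_fun: "\<And>u :: complex^'d \<Rightarrow> complex. continuous_on torus u \<Longrightarrow>
      integral\<^sup>L (mu (convergent_fun r \<nu> n)) u = integral\<^sup>L torus_haar
        (\<lambda>w. of_real (Re ((1 + convergent_fun r \<nu> n w) / (1 - convergent_fun r \<nu> n w))) * u w)"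
proof -
  note h = convergent_fun_polydisc_algebra[of n] convergent_fun_bound[of _ n]
  have eq: "mu (convergent_fun r \<nu> n) = density torus_haar
      (\<lambda>w. ennreal (Re ((1 + convergent_fun r \<nu> n w) / (1 - convergent_fun r \<nu> n w))))"
    by (rule mu_eqI[OF cayley_density_represents[OF h]])
  show "represents_on_torus (mu (convergent_fun r \<nu> n)) (convergent_fun r \<nu> n)"
    unfolding eq by (rule cayley_density_represents[OF h])
  show "integral\<^sup>L (mu (convergent_fun r \<nu> n)) u = integral\<^sup>L torus_haar
      (\<lambda>w. of_real (Re ((1 + convergent_fun r \<nu> n w) / (1 - convergent_fun r \<nu> n w))) * u w)"
    if "continuous_on torus u" for u :: "complex^'d \<Rightarrow> complex"
    unfolding eq by (rule integral_cayley_density[OF h that])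
qed

text \<open>
  The integral has its final value as soon as \<open>n\<close> reaches the larger index, because only the level \<open>j\<close> of the Schur
  algorithm enters: the later parameters are absorbed into the remainder \<open>y j\<close>, which vanishes at the
  origin.
\<close>
lemma integral_Phi_mu_convergent_fun:
  assumes "k \<le> j" "j \<le> n"
  shows "integral\<^sup>L (mu (convergent_fun r \<nu> n)) (\<lambda>w. Phi r \<nu> j w * cnj (Phi r \<nu> k w)) =
    (if j = k then complex_of_real (\<Prod>s=1..j. 1 - (norm (r s))\<^sup>2) else 0)"
proof -
  define a where "a i = schur_tail r \<nu> i (Suc n - i)" for i
  define y where "y i = (\<lambda>z. z $ \<nu> (Suc i) * a (Suc i) z)" for i
  let ?\<omega> = "\<Prod>s=1..j. 1 - (norm (r s))\<^sup>2"
  have a: "a i z = (y i z + r i) / (1 + cnj (r i) * y i z)" if "i \<le> n" for i z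
    using r1[of i] that by (simp add: a_def y_def Suc_diff_le g_op_def m_op_def)
  have y_alg: "y i \<in> polydisc_algebra" for i
    unfolding y_def a_def
    by (intro polydisc_algebra_mult polydisc_algebra_coordinate schur_tail_polydisc_algebra r1)
  have y1: "norm (y i z) < 1" if z: "z \<in> closed_polydisc" for i z
  proof -
    have "norm (y i z) \<le> norm (a (Suc i) z)"
      using z by (simp add: y_def norm_mult closed_polydisc_def mult_left_le_one_le)
    also have "\<dots> < 1" unfolding a_def by (rule schur_tail_bound[where r = r, OF r1 z])
    finally show ?thesis .
  qed
  have density: "Re ((1 + convergent_fun r \<nu> n w) / (1 - convergent_fun r \<nu> n w)) =
      ?\<omega> * ((1 - (norm (y j w))\<^sup>2) / (norm (Phi_star r \<nu> j w - y j w * Phi r \<nu> j w))\<^sup>2)"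
    if w: "w \<in> torus" for w
  proof -
    have wc: "w \<in> closed_polydisc" using w torus_subset by auto
    have "convergent_fun r \<nu> n w = a 0 w" by (simp add: convergent_fun_eq_schur_tail a_def)
    then show ?thesis
      using density_transfer[where r = r, OF r0 r1 w, of j "\<lambda>i. a i w" "\<lambda>i. y i w" \<nu>] a y1[OF wc] \<open>j \<le> n\<close>
      by (simp add: Re_cayley y_def)
  qed
  have cont: "continuous_on torus (\<lambda>w. Phi r \<nu> j w * cnj (Phi r \<nu> k w))"
    by (intro continuous_intros continuous_on_torus_polydisc_algebra conjunct1[OF Phi_polydisc_algebra])
  have "integral\<^sup>L (mu (convergent_fun r \<nu> n)) (\<lambda>w. Phi r \<nu> j w * cnj (Phi r \<nu> k w)) =
    integral\<^sup>L torus_haar (\<lambda>w. of_real ?\<omega> * (of_real ((1 - (norm (y j w))\<^sup>2) /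
      (norm (Phi_star r \<nu> j w - y j w * Phi r \<nu> j w))\<^sup>2) * (Phi r \<nu> j w * cnj (Phi r \<nu> k w))))"
    unfolding integral_mu_convergent_fun[OF cont]
    by (intro Bochner_Integration.integral_cong refl)
      (simp add: space_torus_measure[OF sets_torus_haar] density)
  also have "\<dots> = of_real ?\<omega> * (if j = k then 1 else 0)"
    unfolding integral_mult_right_zero
    by (subst integral_Phi_against_density[where r = r, OF r1 \<open>k \<le> j\<close> y_alg y1])
      (simp_all add: y_def)
  finally show ?thesis by simp
qed

end

theorem theorem2:
  fixes f :: "complex^'d::finite \<Rightarrow> complex"
    and r :: "nat \<Rightarrow> complex"
    and \<nu> :: "nat \<Rightarrow> 'd"
  assumes "f \<in> schur_class"
    and "schur_parameters f r \<nu>"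
    and "standard_schur f r"
  shows "converges_weakly_on_torus (\<lambda>n. mu (convergent_fun r \<nu> n)) (mu f) \<and>
    (\<forall>j k. integral\<^sup>L (mu f) (\<lambda>w. Phi r \<nu> j w * cnj (Phi r \<nu> k w)) =
       (if j = k then complex_of_real (\<Prod>s=1..j. 1 - (norm (r s))\<^sup>2) else 0))"
proof -
  obtain h where alg: "schur_algorithm f r \<nu> h"
    using assms(2) by (auto simp: schur_parameters_def)
  have r1: "norm (r n) < 1" for n using assms(3) by (simp add: standard_schur_def)
  have r0: "r 0 = 0" using alg assms(3) by (auto simp: schur_algorithm_def standard_schur_def)
  have step: "h n z = g_op (r n) (m_op (\<nu> (Suc n)) (h (Suc n))) z" if "z \<in> polydisc" for n z
    using alg that by (simp add: schur_algorithm_def)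
  have h0: "h 0 = f" using alg by (simp add: schur_algorithm_def)
  have bound: "norm (h n z) \<le> 1" if "z \<in> polydisc" for n z
  proof -
    have "h n \<in> hol_class"
      using alg closure_of_subset_topspace[of compact_convergence finite_schur_functions]
      by (auto simp: schur_algorithm_def schur_class_def topspace_compact_convergence)
    then show ?thesis using that by (simp add: hol_class_def)
  qed
  let ?F = "\<lambda>h z. Re ((1 + h z) / (1 - h z))"
  let ?c = "convergent_fun r \<nu>"
  have lim: "(\<lambda>n. ?c n z) \<longlonglongrightarrow> f z" if z: "z \<in> polydisc" for z
    unfolding convergent_fun_eq_schur_tail h0[symmetric]
    using schur_tail_tendsto[where r = r and h = h and \<nu> = \<nu>, OF r1 z bound[OF z] step[OF z]] by (rule LIMSEQ_Suc)
  \<comment> \<open>As \<open>r 0 = 0\<close>, \<open>f z\<close> is the product of a coordinate of \<open>z\<close> and \<open>h 1 z\<close>.\<close>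
  have f_ne_1: "f z \<noteq> 1" if z: "z \<in> polydisc" for z
  proof -
    have "norm (z $ \<nu> 1) < 1" using z by (simp add: polydisc_def)
    moreover have "norm (f z) \<le> norm (z $ \<nu> 1)"
      using step[OF z, of 0] bound[OF z, of 1] h0 r0
      by (simp add: g_op_def m_op_def norm_mult mult_left_le)
    ultimately show ?thesis by auto
  qed
  have limF: "(\<lambda>n. ?F (?c n) z) \<longlonglongrightarrow> ?F f z" if "z \<in> polydisc" for z
    using f_ne_1[OF that] by (intro tendsto_intros lim that) auto
  define N where "N n = mu (?c n)" for n
  have N: "represents_on_torus (N n) (?c n)" for n
    unfolding N_def by (rule mu_convergent_fun_represents[where r = r, OF r0 r1])
  have probN: "prob_space (N n)" for n
    by (rule represents_on_torus_prob[OF N convergent_fun_at_0[where r = r, OF r0 r1]])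
  have setsN: "sets (N n) = sets (restrict_space borel torus)" for n
    using N by (simp add: represents_on_torus_def)
  have intN: "integral\<^sup>L (N n) (poisson_kernel z) = ?F (?c n) z" if "z \<in> polydisc" for n z
    using N that by (auto simp: represents_on_torus_def has_bochner_integral_iff)
  obtain s M where s: "strict_mono s" and M: "prob_space M" "sets M = sets (restrict_space borel torus)"
    and conv: "converges_weakly_on_torus (N \<circ> s) M"
    using prob_measures_on_torus_compact[of N, OF probN setsN] by blast
  have finM: "finite_measure M" using M(1) by (auto simp: prob_space_def)
  have intM: "integral\<^sup>L M (poisson_kernel z) = ?F f z" if z: "z \<in> polydisc" for z
  proof -
    have "(\<lambda>n. integral\<^sup>L ((N \<circ> s) n) (\<lambda>w. complex_of_real (poisson_kernel z w))) \<longlonglongrightarrow>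
        integral\<^sup>L M (\<lambda>w. complex_of_real (poisson_kernel z w))"
      using conv continuous_on_of_real[OF continuous_poisson_kernel[OF z]]
      unfolding converges_weakly_on_torus_def by blast
    then have "(\<lambda>n. complex_of_real (?F (?c (s n)) z)) \<longlonglongrightarrow>
        complex_of_real (integral\<^sup>L M (poisson_kernel z))"
      by (simp add: intN[OF z])
    moreover have "(\<lambda>n. complex_of_real (?F (?c (s n)) z)) \<longlonglongrightarrow> complex_of_real (?F f z)"
      using LIMSEQ_subseq_LIMSEQ[OF limF[OF z] s] by (intro tendsto_of_real) (simp add: o_def)
    ultimately show ?thesis using LIMSEQ_unique of_real_eq_iff by blast
  qed
  have "represents_on_torus M f"
    using M intM continuous_torus_integrable[OF finM M(2) continuous_poisson_kernel]
    by (auto simp: represents_on_torus_def has_bochner_integral_iff)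
  then have mu: "mu f = M" by (rule mu_eqI)
  have weak: "converges_weakly_on_torus N M"
  proof (rule weak_convergence_from_poisson_integrals)
    show "finite_measure (N n)" for n using probN[of n] by (auto simp: prob_space_def)
    show "(\<lambda>n. integral\<^sup>L (N n) (poisson_kernel z)) \<longlonglongrightarrow> integral\<^sup>L M (poisson_kernel z)"
      if "z \<in> polydisc" for z
      using limF[OF that] by (simp add: intN[OF that] intM[OF that])
  qed (use finM setsN M in auto)
  have ortho: "integral\<^sup>L M (\<lambda>w. Phi r \<nu> j w * cnj (Phi r \<nu> k w)) =
      (if j = k then complex_of_real (\<Prod>s=1..j. 1 - (norm (r s))\<^sup>2) else 0)" if "k \<le> j" for j k
  proof -
    have cont: "continuous_on torus (\<lambda>w. Phi r \<nu> j w * cnj (Phi r \<nu> k w))"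
      by (intro continuous_intros continuous_on_torus_polydisc_algebra conjunct1[OF Phi_polydisc_algebra])
    have "(\<lambda>n. integral\<^sup>L (N n) (\<lambda>w. Phi r \<nu> j w * cnj (Phi r \<nu> k w))) \<longlonglongrightarrow>
        integral\<^sup>L M (\<lambda>w. Phi r \<nu> j w * cnj (Phi r \<nu> k w))"
      using weak cont by (simp add: converges_weakly_on_torus_def)
    moreover have "(\<lambda>n. integral\<^sup>L (N n) (\<lambda>w. Phi r \<nu> j w * cnj (Phi r \<nu> k w))) \<longlonglongrightarrow>
        (if j = k then complex_of_real (\<Prod>s=1..j. 1 - (norm (r s))\<^sup>2) else 0)"
      unfolding N_def
      using integral_Phi_mu_convergent_fun[where r = r and \<nu> = \<nu>, OF r0 r1 that]
      by (intro tendsto_eventually eventually_sequentiallyI[of j]) auto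
    ultimately show ?thesis by (rule LIMSEQ_unique)
  qed
  have "integral\<^sup>L M (\<lambda>w. Phi r \<nu> j w * cnj (Phi r \<nu> k w)) =
      (if j = k then complex_of_real (\<Prod>s=1..j. 1 - (norm (r s))\<^sup>2) else 0)" for j k
  proof (cases "k \<le> j")
    case False
    have "integral\<^sup>L M (\<lambda>w. Phi r \<nu> j w * cnj (Phi r \<nu> k w)) =
        integral\<^sup>L M (\<lambda>w. cnj (Phi r \<nu> k w * cnj (Phi r \<nu> j w)))"
      by (simp add: mult.commute)
    also have "\<dots> = cnj (integral\<^sup>L M (\<lambda>w. Phi r \<nu> k w * cnj (Phi r \<nu> j w)))"
      by (rule Bochner_Integration.integral_cnj)
    finally show ?thesis using ortho[of j k] False by simp
  qed (rule ortho)
  then show ?thesis using weak by (simp add: mu N_def[abs_def])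
qed

end
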